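(* Let $M$, $K$, $N$, $W$ be the finite element mass, stiffness, convection and (local projection) stabilization matrices described in the context, for a diffusion coefficient $\epsilon>0$ and a divergence-free wind $\mathbf{w}$, and let $L=\epsilon K+N+W$. Assume that $\mathbf{w}\cdot\mathbf{n}=0$ on $\partial\Omega_N$ (no restriction if $\partial\Omega_N=\emptyset$; the heat equation case $\mathbf{w}=\mathbf{0}$, $\epsilon=1$, $N=W=0$ is allowed with any Dirichlet, Neumann or mixed boundary conditions). Let $\beta>0$, $t_f>0$, $n_t\ge 1$ an integer, $\tau=t_f/n_t$, and let the $n_tn_x\times n_tn_x$ matrices $A_D,C_D,T_1,T_2,\Lambda_{21},\widehat{M}$ be as in the context. Set $$A=T_1A_DT_1^\top,\qquad B=T_2\Lambda_{21},\qquad C=T_2C_DT_2^\top,$$ let $S=C+BA^{-1}B^\top$ be the (negative) Schur complement of the symmetric saddle-point matrix $\begin{bmatrix} A & B^\top \\ B & -C \end{bmatrix}$, and let $$\widehat{S}=T_2(\Lambda_{21}+\widehat{M})\,A^{-1}\,(\Lambda_{21}+\widehat{M})^\top T_2^\top .$$ Then every eigenvalue of $\widehat{S}^{-1}S$ lies in the interval $\left[\tfrac12,1\right]$.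
   Context: Spatial discretization. $\Omega\subset\mathbb{R}^d$, $d\in\{1,2,3\}$, is a bounded (Lipschitz) domain with boundary $\partial\Omega=\partial\Omega_D\cup\partial\Omega_N$, $\partial\Omega_D\cap\partial\Omega_N=\emptyset$, outer unit normal $\mathbf{n}$, and $\mathbf{w}$ is a time-independent vector field on $\overline\Omega$, regular enough for Green's theorem, with $\nabla\cdot\mathbf{w}=0$. Let $\{\phi_i\}_{i=1}^{n_x}$ be linearly independent continuous, piecewise polynomial finite element basis functions on $\Omega$ vanishing on $\partial\Omega_D$. For $i,j=1,\dots,n_x$ define the real $n_x\times n_x$ matrices $$k_{ij}=\int_\Omega\nabla\phi_i\cdot\nabla\phi_j\,d\Omega,\quad n_{ij}=\int_\Omega(\mathbf{w}\cdot\nabla\phi_j)\phi_i\,d\Omega,\quad m_{ij}=\int_\Omega\phi_i\phi_j\,d\Omega,$$ $K=(k_{ij})$, $N=(n_{ij})$, $M=(m_{ij})$. The stabilization matrix $W=(w_{ij})$ is defined as follows: $\Omega$ is partitioned into patches $\mathtt{P}_k$ (each a union of finite elements), $\pi_h(v)|_{\mathtt{P}_k}=\frac{1}{|\mathtt{P}_k|}\int_{\mathtt{P}_k}v$ is the patchwise mean, and $$w_{ij}=\sum_k\delta_k\int_{\mathtt{P}_k}[\mathbf{w}\cdot\nabla\phi_i-\pi_h(\mathbf{w}\cdot\nabla\phi_i)]\,[\mathbf{w}\cdot\nabla\phi_j-\pi_h(\mathbf{w}\cdot\nabla\phi_j)]\,d\Omega,$$ where $\delta_k=\frac{h_k}{2\|\mathbf{w}_k\|}\left(1-\frac1{P_k}\right)$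 if $P_k>1$ and $\delta_k=0$ if $P_k\le1$, with $P_k=\frac{\|\mathbf{w}_k\|h_k}{2\epsilon}$, $\|\mathbf{w}_k\|$ the Euclidean norm of $\mathbf{w}$ at the centroid of $\mathtt{P}_k$, and $h_k>0$ a measure of the length of $\mathtt{P}_k$ in the direction of the wind. Time discretization (Crank--Nicolson). Put $L^+=\frac{\tau}{2}L+M$, $L^-=\frac{\tau}{2}L-M$. Let $I_m$ be the $m\times m$ identity and let $E\in\mathbb{R}^{n_t\times n_t}$ have ones on the first subdiagonal and zeros elsewhere; $\otimes$ is the Kronecker product. The $n_t n_x\times n_t n_x$ matrices are $$A_D=\tfrac{\tau}{2}\,I_{n_t}\otimes M,\qquad C_D=\tfrac{\tau}{2\beta}\,I_{n_t}\otimes M,\qquad T_2=(I_{n_t}+E)\otimes I_{n_x},\qquad T_1=T_2^\top,$$ $$\Lambda_{21}=I_{n_t}\otimes L^+ + E\otimes L^-,\qquad \widehat{M}=\tfrac{\tau}{2\sqrt\beta}\,(I_{n_t}+E)\otimes M .$$ (So $\Lambda_{21}$ is block lower bidiagonal with diagonal blocks $L^+$ and subdiagonal blocks $L^-$; $\widehat M$ is block lower bidiagonal with all nonzero blocks equal to $\frac{\tau}{2\sqrt\beta}M$.) *)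

theory Defs
  imports
    "HOL-Analysis.Analysis"
    "Jordan_Normal_Form.Gauss_Jordan_Elimination"
    "Jordan_Normal_Form.Char_Poly"
begin

section \<open>Hausdorff measure, used as surface measure on the boundary\<close>

text \<open>The normalisation makes the $k$-dimensional measure agree with
  $k$-dimensional Lebesgue measure on $k$-planes, and with counting measure for $k = 0$
  (hence the separate treatment of the empty set, since \<open>0 ^ 0 = 1\<close>).\<close>

definition hausdorff_gauge :: "nat \<Rightarrow> 'a::metric_space set \<Rightarrow> ennreal" where
  "hausdorff_gauge k C =
     (if C = {} then 0 else ennreal (unit_ball_vol (real k) * (diameter C / 2) ^ k))"

definition hausdorff_covers :: "real \<Rightarrow> 'a::metric_space set \<Rightarrow> (nat \<Rightarrow> 'a set) set" where
  "hausdorff_covers \<delta> X =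
     {C. X \<subseteq> (\<Union>i. C i) \<and> (\<forall>i. bounded (C i) \<and> diameter (C i) \<le> \<delta>)}"

definition hausdorff_outer :: "nat \<Rightarrow> 'a::metric_space set \<Rightarrow> ennreal" where
  "hausdorff_outer k X =
     (SUP \<delta>\<in>{0<..}. INF C\<in>hausdorff_covers \<delta> X. \<Sum>i. hausdorff_gauge k (C i))"

text \<open>The \<open>\<sigma>\<close>-algebra consists of all Caratheodory-measurable sets.\<close>

definition hausdorff_measure :: "nat \<Rightarrow> 'a::metric_space measure" where
  "hausdorff_measure k =
     measure_of UNIV (lambda_system UNIV UNIV (hausdorff_outer k)) (hausdorff_outer k)"

lemma outer_measure_space_hausdorff:
  "outer_measure_space UNIV (hausdorff_outer k :: 'a::metric_space set \<Rightarrow> ennreal)"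
  unfolding outer_measure_space_def
proof (intro conjI)
  have "hausdorff_outer k ({} :: 'a set) \<le> 0"
    unfolding hausdorff_outer_def
  proof (rule SUP_least)
    fix \<delta> :: real assume "\<delta> \<in> {0<..}"
    then have "(\<lambda>_. {}) \<in> hausdorff_covers \<delta> ({} :: 'a set)"
      by (simp add: hausdorff_covers_def)
    then show "(INF C\<in>hausdorff_covers \<delta> ({} :: 'a set). \<Sum>i. hausdorff_gauge k (C i)) \<le> 0"
      by (rule INF_lower2) (simp add: hausdorff_gauge_def)
  qed
  then show "positive UNIV (hausdorff_outer k :: 'a set \<Rightarrow> ennreal)"
    by (simp add: positive_def)
  show "increasing UNIV (hausdorff_outer k :: 'a set \<Rightarrow> ennreal)"
    unfolding increasing_def hausdorff_outer_def
    by (intro ballI impI SUP_mono' INF_superset_mono) (auto simp: hausdorff_covers_def)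
  show "countably_subadditive UNIV (hausdorff_outer k :: 'a set \<Rightarrow> ennreal)"
    unfolding countably_subadditive_def
  proof (intro allI impI)
    fix X :: "nat \<Rightarrow> 'a set"
    let ?H = "\<lambda>\<delta> Y. INF C\<in>hausdorff_covers \<delta> Y. \<Sum>i. hausdorff_gauge k (C i)"
    have *: "?H \<delta> (\<Union>i. X i) \<le> (\<Sum>i. ?H \<delta> (X i))" for \<delta>
    proof (rule ennreal_le_epsilon)
      fix e :: real
      assume fin: "(\<Sum>i. ?H \<delta> (X i)) < Orderings.top" and e: "0 < e"
      have "\<exists>C\<in>hausdorff_covers \<delta> (X i).
              (\<Sum>j. hausdorff_gauge k (C j)) < ?H \<delta> (X i) + ennreal (e * (1/2) ^ Suc i)" for i
      proof -
        have "?H \<delta> (X i) < Orderings.top"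
          using fin by (rule ennreal_suminf_lessD)
        then have "?H \<delta> (X i) < ?H \<delta> (X i) + ennreal (e * (1/2) ^ Suc i)"
          using e ennreal_add_left_cancel_less[of "?H \<delta> (X i)" 0 "ennreal (e * (1/2) ^ Suc i)"]
          by (simp add: less_top[symmetric] del: INF_less_iff)
        then show ?thesis
          by (rule INF_less_iff[THEN iffD1])
      qed
      then have "\<exists>C. \<forall>i. C i \<in> hausdorff_covers \<delta> (X i) \<and>
                  (\<Sum>j. hausdorff_gauge k (C i j)) < ?H \<delta> (X i) + ennreal (e * (1/2) ^ Suc i)"
        by (intro choice allI) (simp only: Bex_def)
      then obtain C where "\<forall>i. C i \<in> hausdorff_covers \<delta> (X i) \<and>
          (\<Sum>j. hausdorff_gauge k (C i j)) < ?H \<delta> (X i) + ennreal (e * (1/2) ^ Suc i)"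
        by (rule exE)
      then have C: "C i \<in> hausdorff_covers \<delta> (X i)"
        and le: "(\<Sum>j. hausdorff_gauge k (C i j)) < ?H \<delta> (X i) + ennreal (e * (1/2) ^ Suc i)" for i
        by (simp_all only:)
      define D where "D = (\<lambda>n. case prod_decode n of (i, j) \<Rightarrow> C i j)"
      have "D \<in> hausdorff_covers \<delta> (\<Union>i. X i)"
      proof -
        have "x \<in> (\<Union>n. D n)" if "x \<in> X i" for x i
        proof -
          obtain j where "x \<in> C i j"
            using C[of i] \<open>x \<in> X i\<close> by (auto simp: hausdorff_covers_def)
          then have "x \<in> D (prod_encode (i, j))" by (simp add: D_def)
          then show ?thesis by blast
        qed
        then have "(\<Union>i. X i) \<subseteq> (\<Union>n. D n)" by blast
        moreover have "bounded (D n) \<and> diameter (D n) \<le> \<delta>" for n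
          using C[of "fst (prod_decode n)"] by (simp add: hausdorff_covers_def D_def case_prod_beta)
        ultimately show ?thesis by (simp add: hausdorff_covers_def)
      qed
      then have "?H \<delta> (\<Union>i. X i) \<le> (\<Sum>n. hausdorff_gauge k (D n))"
        by (rule INF_lower)
      also have "\<dots> = (\<Sum>i. \<Sum>j. hausdorff_gauge k (C i j))"
        using suminf_ennreal_2dimen[of "\<lambda>i. \<Sum>j. hausdorff_gauge k (C i j)"
            "\<lambda>(i, j). hausdorff_gauge k (C i j)"]
        by (simp add: D_def comp_def case_prod_unfold)
      also have "\<dots> \<le> (\<Sum>i. ?H \<delta> (X i) + ennreal (e * (1/2) ^ Suc i))"
        by (rule suminf_le[OF less_imp_le[OF le] summableI summableI])
      also have "\<dots> = (\<Sum>i. ?H \<delta> (X i)) + (\<Sum>i. ennreal (e * (1/2) ^ Suc i))"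
        by (rule suminf_add[symmetric]; rule summableI)
      also have "(\<Sum>i. ennreal (e * (1/2) ^ Suc i)) = ennreal e"
      proof -
        have "(\<lambda>i. e * (1/2) ^ Suc i) sums (e * 1)"
          by (rule sums_mult[OF power_half_series])
        then have "(\<Sum>i. ennreal (e * (1/2) ^ Suc i)) = ennreal (e * 1)"
          using e by (intro suminf_ennreal_eq) simp_all
        then show ?thesis by (simp only: mult_1_right)
      qed
      finally show "?H \<delta> (\<Union>i. X i) \<le> (\<Sum>i. ?H \<delta> (X i)) + ennreal e" .
    qed
    show "hausdorff_outer k (\<Union>i. X i) \<le> (\<Sum>i. hausdorff_outer k (X i))"
      unfolding hausdorff_outer_def
    proof (rule SUP_least)
      fix \<delta> :: real assume "\<delta> \<in> {0<..}"
      show "?H \<delta> (\<Union>i. X i) \<le> (\<Sum>i. SUP \<delta>\<in>{0<..}. ?H \<delta> (X i))"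
      proof (rule order_trans[OF *])
        have "?H \<delta> (X i) \<le> (SUP \<delta>\<in>{0<..}. ?H \<delta> (X i))" for i
          using \<open>\<delta> \<in> {0<..}\<close> by (rule SUP_upper)
        then show "(\<Sum>i. ?H \<delta> (X i)) \<le> (\<Sum>i. SUP \<delta>\<in>{0<..}. ?H \<delta> (X i))"
          by (intro suminf_le summableI)
      qed
    qed
  qed
qed

lemma emeasure_hausdorff_measure:
  assumes "X \<in> sets (hausdorff_measure k)"
  shows "emeasure (hausdorff_measure k) X = hausdorff_outer k X"
proof -
  interpret sigma_algebra UNIV "UNIV :: 'a set set"
    using sigma_algebra_Pow[of "UNIV :: 'a set"] by simp
  have "measure_space UNIV (lambda_system UNIV UNIV (hausdorff_outer k))
          (hausdorff_outer k :: 'a set \<Rightarrow> ennreal)"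
    by (rule caratheodory_lemma) (rule outer_measure_space_hausdorff)
  then show ?thesis
    using assms unfolding hausdorff_measure_def measure_space_def
    by (auto simp: sigma_algebra.sigma_sets_eq intro!: emeasure_measure_of_sigma)
qed


section \<open>Domains, normals and Green's theorem\<close>

definition lipschitz_domain :: "'a::euclidean_space set \<Rightarrow> bool" where
  "lipschitz_domain \<Omega> \<longleftrightarrow>
     \<Omega> \<noteq> {} \<and> open \<Omega> \<and> connected \<Omega> \<and> bounded \<Omega> \<and>
     (\<forall>x\<in>frontier \<Omega>. \<exists>U e \<gamma> C. open U \<and> x \<in> U \<and> norm e = 1 \<and>
        C-lipschitz_on {y. inner y e = 0} \<gamma> \<and>
        \<Omega> \<inter> U = {y \<in> U. \<gamma> (y - inner y e *\<^sub>R e) < inner y e})"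

text \<open>The unit vector \<open>\<nu>\<close> is the outer normal at \<open>x\<close> if \<open>\<Omega>\<close> is, to first order at \<open>x\<close>,
  the half space \<open>{y. inner (y - x) \<nu> < 0}\<close>. For a Lipschitz domain this is
  differentiability of the local graph at \<open>x\<close>, hence holds at almost every boundary point.\<close>

definition is_outer_normal :: "'a::euclidean_space set \<Rightarrow> 'a \<Rightarrow> 'a \<Rightarrow> bool" where
  "is_outer_normal \<Omega> x \<nu> \<longleftrightarrow> norm \<nu> = 1 \<and>
     (\<forall>\<eta>>0. \<exists>r>0. \<forall>y\<in>ball x r.
        (y \<in> \<Omega> \<longrightarrow> inner (y - x) \<nu> \<le> \<eta> * norm (y - x)) \<and>
        (y \<notin> \<Omega> \<longrightarrow> inner (y - x) \<nu> \<ge> - \<eta> * norm (y - x)))"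

text \<open>The value \<open>0\<close> is a placeholder at boundary points (corners, edges) without a normal.\<close>

definition outer_normal :: "'a::euclidean_space set \<Rightarrow> 'a \<Rightarrow> 'a" where
  "outer_normal \<Omega> x =
     (if \<exists>\<nu>. is_outer_normal \<Omega> x \<nu> then THE \<nu>. is_outer_normal \<Omega> x \<nu> else 0)"

definition gradient :: "('a::euclidean_space \<Rightarrow> real) \<Rightarrow> 'a \<Rightarrow> 'a" where
  "gradient f x = (THE D. GDERIV f x :> D)"

definition divergence :: "('a::euclidean_space \<Rightarrow> 'a) \<Rightarrow> 'a \<Rightarrow> real" where
  "divergence w x = (\<Sum>b\<in>Basis. inner (frechet_derivative w (at x) b) b)"

text \<open>Elements are closed; distinct elements may share boundary points.\<close>

definition fe_mesh :: "'a::euclidean_space set \<Rightarrow> 'a set set \<Rightarrow> bool" where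
  "fe_mesh \<Omega> \<T> \<longleftrightarrow>
     finite \<T> \<and> \<Union>\<T> = closure \<Omega> \<and>
     (\<forall>T\<in>\<T>. interior T \<noteq> {} \<and> closure (interior T) = T \<and> negligible (frontier T)) \<and>
     (\<forall>T\<in>\<T>. \<forall>T'\<in>\<T>. T \<noteq> T' \<longrightarrow> interior T \<inter> interior T' = {})"

definition continuous_piecewise_polynomial ::
    "'a::euclidean_space set \<Rightarrow> 'a set set \<Rightarrow> ('a \<Rightarrow> real) \<Rightarrow> bool" where
  "continuous_piecewise_polynomial \<Omega> \<T> v \<longleftrightarrow>
     continuous_on (closure \<Omega>) v \<and>
     (\<forall>T\<in>\<T>. \<exists>p. real_polynomial_function p \<and> (\<forall>x\<in>T. v x = p x))"

text \<open>Green's formula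
  $\int_\Omega w\cdot\nabla v + \int_\Omega v\,\nabla\cdot w = \int_{\partial\Omega} v\,w\cdot n$
  for all continuous piecewise polynomials \<open>v\<close> on the mesh, of any degree: this is the sense in
  which \<open>w\<close> is regular enough for Green's theorem. It holds for instance if \<open>\<Omega>\<close> is a Lipschitz
  domain and \<open>w\<close> is continuously differentiable up to the boundary.\<close>

definition greens_theorem_applies ::
    "'a::euclidean_space set \<Rightarrow> 'a set set \<Rightarrow> ('a \<Rightarrow> 'a) \<Rightarrow> bool" where
  "greens_theorem_applies \<Omega> \<T> w \<longleftrightarrow>
     continuous_on (closure \<Omega>) w \<and> w differentiable_on \<Omega> \<and>
     (\<forall>v. continuous_piecewise_polynomial \<Omega> \<T> v \<longrightarrow>
        (LINT x:\<Omega>|lebesgue. inner (w x) (gradient v x)) +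
        (LINT x:\<Omega>|lebesgue. v x * divergence w x) =
        (LINT x:frontier \<Omega>|hausdorff_measure (DIM('a) - 1). v x * inner (w x) (outer_normal \<Omega> x)))"


section \<open>Finite element matrices\<close>

definition fe_basis ::
    "'a::euclidean_space set \<Rightarrow> 'a set set \<Rightarrow> 'a set \<Rightarrow> nat \<Rightarrow> (nat \<Rightarrow> 'a \<Rightarrow> real) \<Rightarrow> bool" where
  "fe_basis \<Omega> \<T> \<Gamma>\<^sub>D n \<phi> \<longleftrightarrow>
     (\<forall>i<n. continuous_piecewise_polynomial \<Omega> \<T> (\<phi> i) \<and> (\<forall>x\<in>\<Gamma>\<^sub>D. \<phi> i x = 0)) \<and>
     (\<forall>c :: nat \<Rightarrow> real. (\<forall>x\<in>\<Omega>. (\<Sum>i<n. c i * \<phi> i x) = 0) \<longrightarrow> (\<forall>i<n. c i = 0))"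

definition stiffness_mat ::
    "'a::euclidean_space set \<Rightarrow> nat \<Rightarrow> (nat \<Rightarrow> 'a \<Rightarrow> real) \<Rightarrow> real mat" where
  "stiffness_mat \<Omega> n \<phi> =
     mat n n (\<lambda>(i, j). LINT x:\<Omega>|lebesgue. inner (gradient (\<phi> i) x) (gradient (\<phi> j) x))"

definition convection_mat ::
    "'a::euclidean_space set \<Rightarrow> ('a \<Rightarrow> 'a) \<Rightarrow> nat \<Rightarrow> (nat \<Rightarrow> 'a \<Rightarrow> real) \<Rightarrow> real mat" where
  "convection_mat \<Omega> w n \<phi> =
     mat n n (\<lambda>(i, j). LINT x:\<Omega>|lebesgue. inner (w x) (gradient (\<phi> j) x) * \<phi> i x)"

definition mass_mat ::
    "'a::euclidean_space set \<Rightarrow> nat \<Rightarrow> (nat \<Rightarrow> 'a \<Rightarrow> real) \<Rightarrow> real mat" where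
  "mass_mat \<Omega> n \<phi> = mat n n (\<lambda>(i, j). LINT x:\<Omega>|lebesgue. \<phi> i x * \<phi> j x)"

definition patch_partition :: "'a set set \<Rightarrow> 'a set set \<Rightarrow> bool" where
  "patch_partition \<T> \<P> \<longleftrightarrow> (\<exists>\<Q>. partition_on \<T> \<Q> \<and> \<P> = Union ` \<Q>)"

definition patch_mean :: "'a::euclidean_space set \<Rightarrow> ('a \<Rightarrow> real) \<Rightarrow> real" where
  "patch_mean P v = (LINT x:P|lebesgue. v x) / measure lebesgue P"

definition centroid :: "'a::euclidean_space set \<Rightarrow> 'a" where
  "centroid P = (1 / measure lebesgue P) *\<^sub>R (LINT x:P|lebesgue. x)"

definition patch_peclet ::
    "real \<Rightarrow> ('a::euclidean_space \<Rightarrow> 'a) \<Rightarrow> ('a set \<Rightarrow> real) \<Rightarrow> 'a set \<Rightarrow> real" where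
  "patch_peclet \<epsilon> w h P = norm (w (centroid P)) * h P / (2 * \<epsilon>)"

definition stabilization_weight ::
    "real \<Rightarrow> ('a::euclidean_space \<Rightarrow> 'a) \<Rightarrow> ('a set \<Rightarrow> real) \<Rightarrow> 'a set \<Rightarrow> real" where
  "stabilization_weight \<epsilon> w h P =
     (if patch_peclet \<epsilon> w h P > 1
      then h P / (2 * norm (w (centroid P))) * (1 - 1 / patch_peclet \<epsilon> w h P)
      else 0)"

definition stabilization_mat ::
    "real \<Rightarrow> ('a::euclidean_space \<Rightarrow> 'a) \<Rightarrow> 'a set set \<Rightarrow> ('a set \<Rightarrow> real) \<Rightarrow>
     nat \<Rightarrow> (nat \<Rightarrow> 'a \<Rightarrow> real) \<Rightarrow> real mat" where
  "stabilization_mat \<epsilon> w \<P> h n \<phi> = mat n n (\<lambda>(i, j).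
     let g = (\<lambda>i x. inner (w x) (gradient (\<phi> i) x)) in
     \<Sum>P\<in>\<P>. stabilization_weight \<epsilon> w h P *
       (LINT x:P|lebesgue. (g i x - patch_mean P (g i)) * (g j x - patch_mean P (g j))))"


section \<open>Matrices of the all-at-once system\<close>

definition kronecker :: "'a::times mat \<Rightarrow> 'a mat \<Rightarrow> 'a mat" (infixl "\<otimes>\<^sub>K" 75) where
  "A \<otimes>\<^sub>K B = mat (dim_row A * dim_row B) (dim_col A * dim_col B)
     (\<lambda>(i, j). A $$ (i div dim_row B, j div dim_col B) * B $$ (i mod dim_row B, j mod dim_col B))"

definition subdiagonal_mat :: "nat \<Rightarrow> real mat" where
  "subdiagonal_mat n = mat n n (\<lambda>(i, j). if i = Suc j then 1 else 0)"

text \<open>Meaningful only for invertible arguments.\<close>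

definition inv_mat :: "'a::field mat \<Rightarrow> 'a mat" where
  "inv_mat A = the (mat_inverse A)"

end

(*
  With X = Lambda_21 T_2^{-1} and Y = M_hat T_2^{-1} = A_D / sqrt beta one has
    S     = T_2 (X A_D^{-1} X^T + Y A_D^{-1} Y^T) T_2^T,
    S_hat = T_2 (X + Y) A_D^{-1} (X + Y)^T T_2^T,
  because C_D = A_D / beta = Y A_D^{-1} Y^T.  In the inner product of A_D^{-1} the two quadratic forms are
  |a|^2 + |b|^2 and |a + b|^2; their quotient is at least 1/2 by the parallelogram law, and at most 1 as
  soon as the cross term is nonnegative.  The cross term is a positive multiple of
  <T_2 y, Lambda_21 y>, i.e. of the sum over the time steps a of
    tau/2 <y_a + y_{a-1}, L (y_a + y_{a-1})> + <y_a + y_{a-1}, M (y_a - y_{a-1})>.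
  The M-part telescopes to |y_last|_M^2, and the L-part is nonnegative: K and W are Gram matrices up to
  nonnegative weights, and by Green's formula for v^2 the quadratic form of N vanishes.
*)
theory Submission
  imports Defs
begin

unbundle no inner_syntax
unbundle no vec_syntax

section \<open>Positive definite matrices and the matched Schur complement\<close>

text \<open>\<open>S_hat^-1 S\<close> is not symmetric, but it is self-adjoint for the inner product
  of \<open>S_hat\<close>. Its complex eigenvalues are therefore real and are quotients of the two
  quadratic forms. This asks for \<open>S_hat\<close> to be positive definite and not merely
  invertible; the same expansion supplies that, because the cross term is nonnegative and the term
  coming from \<open>Y\<close> is already positive. \<open>X\<close> and \<open>Y\<close> are never
  formed. With \<open>u = T\<^sub>2^T x\<close>, the vectors
  \<open>a = \<Lambda>\<^sub>2\<^sub>1^T u\<close> and \<open>b = M_hat^T u\<close>, measured by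
  \<open>A^-1\<close>, take their place. Since \<open>M_hat\<close> is a multiple of
  \<open>A_D T\<^sub>2\<close>, one has \<open>A^-1 b = y / sqrt \<beta>\<close> where
  \<open>T\<^sub>2 y = u\<close>: this is where the \<open>y\<close> of the cross term comes from.
  On the analytic side the obstacle is that the Bochner integral is additive only on integrable
  functions, while \<open>gradient\<close> has unspecified values on element boundaries. Essential
  boundedness on sets of finite measure survives the products that occur and absorbs the exceptional
  null sets.\<close>

lemma inv_mat_nonsingular:
  fixes A :: "'a::field mat"
  assumes A: "A \<in> carrier_mat n n"
    and inj: "\<And>v. v \<in> carrier_vec n \<Longrightarrow> A *\<^sub>v v = 0\<^sub>v n \<Longrightarrow> v = 0\<^sub>v n"
  shows "inv_mat A \<in> carrier_mat n n" "A * inv_mat A = 1\<^sub>m n" "inv_mat A * A = 1\<^sub>m n"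
    "invertible_mat A"
proof -
  have "det A \<noteq> 0"
    using det_0_iff_vec_prod_zero_field[OF A] inj by auto
  then have "A \<in> Units (ring_mat TYPE('a) n ())"
    by (rule det_non_zero_imp_unit[OF A])
  then obtain B where "mat_inverse A = Some B"
    \<comment> \<open>Gauss-Jordan elimination returns \<open>None\<close> only for non-units of the
      matrix ring, so the \<open>the\<close> in \<open>inv_mat\<close> meets a genuine
      inverse.\<close>
    using mat_inverse(1)[OF A, where b = "()"] by (cases "mat_inverse A") auto
  with mat_inverse(2)[OF A this]
  show *: "inv_mat A \<in> carrier_mat n n" "A * inv_mat A = 1\<^sub>m n" "inv_mat A * A = 1\<^sub>m n"
    by (auto simp: inv_mat_def)
  then show "invertible_mat A"
    using A by (auto simp: invertible_mat_def inverts_mat_def intro!: exI[of _ "inv_mat A"])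
qed

lemma smult_mat_mult_mat_vec_assoc:
  fixes A :: "'a::comm_semiring_0 mat"
  assumes "A \<in> carrier_mat m n" "x \<in> carrier_vec n"
  shows "(k \<cdot>\<^sub>m A) *\<^sub>v x = k \<cdot>\<^sub>v (A *\<^sub>v x)"
  using assms by (intro eq_vecI) (auto simp: scalar_prod_def sum_distrib_left ac_simps)

lemma scalar_prod_transpose_mult_vec:
  fixes A :: "'a::comm_semiring_0 mat"
  assumes "A \<in> carrier_mat m n" "x \<in> carrier_vec n" "y \<in> carrier_vec m"
  shows "x \<bullet> (transpose_mat A *\<^sub>v y) = (A *\<^sub>v x) \<bullet> y"
proof -
  have "x \<bullet> (transpose_mat A *\<^sub>v y) = (transpose_mat A *\<^sub>v y) \<bullet> x"
    using assms by (intro comm_scalar_prod[of _ n]) auto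
  also have "\<dots> = y \<bullet> (A *\<^sub>v x)"
    using assms by (rule transpose_vec_mult_scalar)
  also have "\<dots> = (A *\<^sub>v x) \<bullet> y"
    using assms by (intro comm_scalar_prod[of _ m]) auto
  finally show ?thesis .
qed

lemma symmetric_scalar_prod_commute:
  fixes A :: "'a::comm_semiring_0 mat"
  assumes "A \<in> carrier_mat n n" "transpose_mat A = A" "x \<in> carrier_vec n" "y \<in> carrier_vec n"
  shows "x \<bullet> (A *\<^sub>v y) = y \<bullet> (A *\<^sub>v x)"
  using scalar_prod_transpose_mult_vec[of A n n x y] comm_scalar_prod[of "A *\<^sub>v x" n y] assms
  by auto

definition pos_def_mat :: "nat \<Rightarrow> real mat \<Rightarrow> bool" where
  "pos_def_mat n A \<longleftrightarrow> A \<in> carrier_mat n n \<and> transpose_mat A = A \<and>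
     (\<forall>x\<in>carrier_vec n. x \<noteq> 0\<^sub>v n \<longrightarrow> 0 < x \<bullet> (A *\<^sub>v x))"

lemma pos_def_mat_nonneg:
  assumes "pos_def_mat n A" "x \<in> carrier_vec n"
  shows "0 \<le> x \<bullet> (A *\<^sub>v x)"
proof (cases "x = 0\<^sub>v n")
  case True
  with assms show ?thesis by (auto simp: pos_def_mat_def scalar_prod_def)
qed (use assms in \<open>auto simp: pos_def_mat_def less_imp_le\<close>)

lemma pos_def_mat_inv:
  assumes A: "pos_def_mat n A"
  shows "inv_mat A \<in> carrier_mat n n" "A * inv_mat A = 1\<^sub>m n" "inv_mat A * A = 1\<^sub>m n"
    "invertible_mat A"
proof -
  have c: "A \<in> carrier_mat n n" using A by (simp add: pos_def_mat_def)
  have inj: "v = 0\<^sub>v n" if "v \<in> carrier_vec n" "A *\<^sub>v v = 0\<^sub>v n" for v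
    using A that by (auto simp: pos_def_mat_def)
  show "inv_mat A \<in> carrier_mat n n" "A * inv_mat A = 1\<^sub>m n" "inv_mat A * A = 1\<^sub>m n"
    "invertible_mat A"
    using inv_mat_nonsingular[OF c] inj by blast+
qed

text \<open>The form of \<open>T^T D T\<close> at \<open>x\<close> is the form of \<open>D\<close>
  at \<open>T x\<close>, and injectivity keeps \<open>T x\<close> away from zero. With
  \<open>T\<^sub>1 = T\<^sub>2^T\<close> this is exactly the shape of \<open>A\<close>.\<close>

lemma pos_def_mat_congruence:
  assumes D: "pos_def_mat n D" and T: "T \<in> carrier_mat n n"
    and inj: "\<And>v. v \<in> carrier_vec n \<Longrightarrow> T *\<^sub>v v = 0\<^sub>v n \<Longrightarrow> v = 0\<^sub>v n"
  shows "pos_def_mat n (transpose_mat T * D * T)"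
proof -
  have Dc: "D \<in> carrier_mat n n" "transpose_mat D = D" using D by (auto simp: pos_def_mat_def)
  have "transpose_mat (transpose_mat T * D * T) = transpose_mat T * D * T"
  proof -
    have "transpose_mat (transpose_mat T * D * T) = transpose_mat T * transpose_mat (transpose_mat T * D)"
      using Dc T by (intro transpose_mult[of _ n n _ n]) auto
    also have "transpose_mat (transpose_mat T * D) = D * T"
      using Dc T by (subst transpose_mult[of _ n n _ n]) auto
    also have "transpose_mat T * (D * T) = transpose_mat T * D * T"
      using Dc T by (intro assoc_mult_mat[of _ n n _ n _ n, symmetric]) auto
    finally show ?thesis .
  qed
  moreover have "0 < x \<bullet> (transpose_mat T * D * T *\<^sub>v x)" if x: "x \<in> carrier_vec n" "x \<noteq> 0\<^sub>v n" for x
  proof -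
    have "transpose_mat T * D * T *\<^sub>v x = transpose_mat T *\<^sub>v (D *\<^sub>v (T *\<^sub>v x))"
      using Dc T x by (simp add: assoc_mult_mat_vec[of _ n n _ n])
    moreover have "x \<bullet> (transpose_mat T *\<^sub>v (D *\<^sub>v (T *\<^sub>v x))) = (T *\<^sub>v x) \<bullet> (D *\<^sub>v (T *\<^sub>v x))"
      using Dc T x by (intro scalar_prod_transpose_mult_vec[of _ n n]) auto
    moreover have "0 < (T *\<^sub>v x) \<bullet> (D *\<^sub>v (T *\<^sub>v x))"
      using D T x inj[of x] unfolding pos_def_mat_def by (metis mult_mat_vec_carrier)
    ultimately show ?thesis by simp
  qed
  ultimately show ?thesis using Dc T by (auto simp: pos_def_mat_def)
qed

text \<open>Once the inverse \<open>R\<close> of \<open>A\<close> is known to be symmetric,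
  \<open>R^T A R = R\<close> exhibits it as a congruence of \<open>A\<close>, so the previous result
  applies.\<close>

lemma pos_def_mat_inv_mat:
  assumes A: "pos_def_mat n A"
  shows "pos_def_mat n (inv_mat A)"
proof -
  note i = pos_def_mat_inv[OF A]
  have c: "A \<in> carrier_mat n n" "transpose_mat A = A" using A by (auto simp: pos_def_mat_def)
  have t: "transpose_mat (inv_mat A) = inv_mat A"
  proof -
    have "transpose_mat (inv_mat A) = transpose_mat (inv_mat A) * (A * inv_mat A)"
      using i by simp
    also have "\<dots> = transpose_mat (inv_mat A) * transpose_mat A * inv_mat A"
      using i c by (simp add: assoc_mult_mat[of _ n n _ n _ n])
    also have "transpose_mat (inv_mat A) * transpose_mat A = transpose_mat (A * inv_mat A)"
      using i c by (intro transpose_mult[symmetric]) auto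
    also have "transpose_mat (A * inv_mat A) * inv_mat A = inv_mat A"
      using i by simp
    finally show ?thesis .
  qed
  have inj: "v = 0\<^sub>v n" if "v \<in> carrier_vec n" "inv_mat A *\<^sub>v v = 0\<^sub>v n" for v
  proof -
    have "v = A * inv_mat A *\<^sub>v v" using that i by simp
    also have "\<dots> = A *\<^sub>v (inv_mat A *\<^sub>v v)" using that i c by (intro assoc_mult_mat_vec) auto
    finally show ?thesis using that c by auto
  qed
  have "transpose_mat (inv_mat A) * A * inv_mat A = inv_mat A"
    using i t by simp
  with pos_def_mat_congruence[OF A i(1) inj] show ?thesis by simp
qed

section \<open>Spectral bounds from quadratic forms\<close>

text \<open>For an eigenvector \<open>v = a + i b\<close> one has v^* S v = \<mu> v^* H v. Both
  Hermitian forms are real because \<open>S\<close> and \<open>H\<close> are symmetric, and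
  \<open>t\<close> = v^* H v is positive. Hence \<mu> is a real quotient of forms, which the two
  inequalities enclose. Everything is written with the real vectors \<open>a\<close> and
  \<open>b\<close>, so that only real matrices are handled.\<close>

lemma quadratic_form_complex_eigenvalue:
  fixes S H :: "real mat"
  assumes S: "S \<in> carrier_mat n n" "transpose_mat S = S" and H: "pos_def_mat n H"
    and lo: "\<And>x. x \<in> carrier_vec n \<Longrightarrow> c * (x \<bullet> (H *\<^sub>v x)) \<le> x \<bullet> (S *\<^sub>v x)"
    and hi: "\<And>x. x \<in> carrier_vec n \<Longrightarrow> x \<bullet> (S *\<^sub>v x) \<le> d * (x \<bullet> (H *\<^sub>v x))"
    and ev: "eigenvalue (map_mat complex_of_real (inv_mat H * S)) \<mu>"
  shows "\<mu> \<in> complex_of_real ` {c..d}"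
proof -
  define R where "R = inv_mat H * S"
  note i = pos_def_mat_inv[OF H]
  have Hc: "H \<in> carrier_mat n n" "transpose_mat H = H" using H by (auto simp: pos_def_mat_def)
  have R: "R \<in> carrier_mat n n" using i S by (simp add: R_def)
  have HR: "H *\<^sub>v (R *\<^sub>v x) = S *\<^sub>v x" if "x \<in> carrier_vec n" for x
  proof -
    have "H *\<^sub>v (R *\<^sub>v x) = (H * R) *\<^sub>v x"
      using that R Hc by (simp add: assoc_mult_mat_vec[of _ n n _ n])
    also have "H * R = (H * inv_mat H) * S"
      unfolding R_def using i S Hc by (intro assoc_mult_mat[of _ n n _ n _ n, symmetric]) auto
    finally show ?thesis using i S by simp
  qed
  obtain v where v: "v \<in> carrier_vec n" "v \<noteq> 0\<^sub>v n" "map_mat complex_of_real R *\<^sub>v v = \<mu> \<cdot>\<^sub>v v"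
    using ev R by (auto simp: eigenvalue_def eigenvector_def R_def[symmetric])
  define a b where "a = map_vec Re v" and "b = map_vec Im v"
  have ab: "a \<in> carrier_vec n" "b \<in> carrier_vec n" using v by (auto simp: a_def b_def)
  have dims: "dim_vec v = n" "dim_row R = n" "dim_col R = n" using v R by auto
  have pt: "(\<Sum>j<n. complex_of_real (R $$ (k, j)) * v $ j) = \<mu> * v $ k" if "k < n" for k
    using arg_cong[OF v(3), of "\<lambda>u. u $ k"] that dims
    by (simp add: scalar_prod_def lessThan_atLeast0)
  have Ra: "R *\<^sub>v a = Re \<mu> \<cdot>\<^sub>v a + (- Im \<mu>) \<cdot>\<^sub>v b"
  proof (rule eq_vecI)
    fix k assume "k < dim_vec (Re \<mu> \<cdot>\<^sub>v a + (- Im \<mu>) \<cdot>\<^sub>v b)"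
    then have k: "k < n" using ab by simp
    show "(R *\<^sub>v a) $ k = (Re \<mu> \<cdot>\<^sub>v a + (- Im \<mu>) \<cdot>\<^sub>v b) $ k"
      using arg_cong[OF pt[OF k], of Re] k dims
      by (simp add: scalar_prod_def a_def b_def lessThan_atLeast0)
  qed (use R ab in simp)
  have Rb: "R *\<^sub>v b = Re \<mu> \<cdot>\<^sub>v b + Im \<mu> \<cdot>\<^sub>v a"
  proof (rule eq_vecI)
    fix k assume "k < dim_vec (Re \<mu> \<cdot>\<^sub>v b + Im \<mu> \<cdot>\<^sub>v a)"
    then have k: "k < n" using ab by simp
    show "(R *\<^sub>v b) $ k = (Re \<mu> \<cdot>\<^sub>v b + Im \<mu> \<cdot>\<^sub>v a) $ k"
      using arg_cong[OF pt[OF k], of Im] k dims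
      by (simp add: scalar_prod_def a_def b_def lessThan_atLeast0)
  qed (use R ab in simp)
  \<comment> \<open>Multiplying the real and imaginary parts of the eigenvector equation by
    \<open>H\<close> removes the inverse, since \<open>H R = S\<close>.\<close>
  have form: "x \<bullet> (S *\<^sub>v y) = p * (x \<bullet> (H *\<^sub>v y)) + q * (x \<bullet> (H *\<^sub>v z))"
    if "x \<in> carrier_vec n" "y \<in> carrier_vec n" "z \<in> carrier_vec n" "R *\<^sub>v y = p \<cdot>\<^sub>v y + q \<cdot>\<^sub>v z"
    for x y z p q
  proof -
    have "S *\<^sub>v y = p \<cdot>\<^sub>v (H *\<^sub>v y) + q \<cdot>\<^sub>v (H *\<^sub>v z)"
      using that Hc HR[of y] by (simp add: mult_add_distrib_mat_vec[of _ n n] mult_mat_vec[of _ n n])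
    then show ?thesis
      using that Hc by (simp add: scalar_prod_add_distrib[of _ n])
  qed
  define t where "t = a \<bullet> (H *\<^sub>v a) + b \<bullet> (H *\<^sub>v b)"
  have symH: "a \<bullet> (H *\<^sub>v b) = b \<bullet> (H *\<^sub>v a)" and symS: "a \<bullet> (S *\<^sub>v b) = b \<bullet> (S *\<^sub>v a)"
    using symmetric_scalar_prod_commute Hc S ab by auto
  have "a \<bullet> (S *\<^sub>v a) + b \<bullet> (S *\<^sub>v b) = Re \<mu> * t"
    using form[OF ab(1) ab(1) ab(2) Ra] form[OF ab(2) ab(2) ab(1) Rb] symH
    by (simp add: t_def algebra_simps)
  \<comment> \<open>Symmetry of \<open>S\<close> equates the two mixed values; their difference is
    \<open>Im \<mu>\<close> times the diagonal terms of \<open>H\<close>.\<close>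
  moreover have "Im \<mu> * t = 0"
    using form[OF ab(2) ab(1) ab(2) Ra] form[OF ab(1) ab(2) ab(1) Rb] symH symS
    by (simp add: t_def algebra_simps)
  moreover have "0 < t"
  proof -
    have "a \<noteq> 0\<^sub>v n \<or> b \<noteq> 0\<^sub>v n"
    proof (rule ccontr)
      assume z: "\<not> (a \<noteq> 0\<^sub>v n \<or> b \<noteq> 0\<^sub>v n)"
      have "v $ k = 0" if "k < n" for k
      proof -
        have "a $ k = 0" "b $ k = 0" using z that by auto
        then show ?thesis using that dims by (simp add: a_def b_def complex_eq_iff)
      qed
      with v show False by (auto simp: vec_eq_iff)
    qed
    then show ?thesis
      using H ab pos_def_mat_nonneg[OF H ab(1)] pos_def_mat_nonneg[OF H ab(2)]
      unfolding t_def pos_def_mat_def by (auto intro: add_pos_nonneg add_nonneg_pos)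
  qed
  moreover have "c * t \<le> a \<bullet> (S *\<^sub>v a) + b \<bullet> (S *\<^sub>v b)" "a \<bullet> (S *\<^sub>v a) + b \<bullet> (S *\<^sub>v b) \<le> d * t"
    using lo[OF ab(1)] lo[OF ab(2)] hi[OF ab(1)] hi[OF ab(2)] by (auto simp: t_def algebra_simps)
  ultimately have "Im \<mu> = 0" "c \<le> Re \<mu>" "Re \<mu> \<le> d"
    by auto
  then show ?thesis
    by (intro image_eqI[of _ _ "Re \<mu>"]) (auto simp: complex_eq_iff)
qed

text \<open>Here \<open>D\<close>, \<open>P\<close>, \<open>Q\<close> stand for \<open>A_D\<close>,
  \<open>\<Lambda>\<^sub>2\<^sub>1\<close>, \<open>M_hat\<close>. The choice
  \<open>Q = s D T\<close> is forced by matching: it makes \<open>Q A^-1 Q^T = s^2 D\<close>, so the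
  term \<open>C\<close> of the Schur complement is itself of the form that \<open>P\<close> produces
  in the other term. In the norm of \<open>A^-1\<close> the two forms are then |a|^2 + |b|^2 and |a
  + b|^2. The hypothesis \<open>mono\<close> says that the symmetric part of \<open>T^T P\<close> is
  positive semidefinite, which is the sign of the cross term.\<close>

lemma matched_schur_complement:
  fixes T D P Q A S H :: "real mat" and s :: real
  assumes T: "T \<in> carrier_mat n n"
    and inj: "\<And>v. v \<in> carrier_vec n \<Longrightarrow> T *\<^sub>v v = 0\<^sub>v n \<Longrightarrow> v = 0\<^sub>v n"
    and inj': "\<And>v. v \<in> carrier_vec n \<Longrightarrow> transpose_mat T *\<^sub>v v = 0\<^sub>v n \<Longrightarrow> v = 0\<^sub>v n"
    and D: "pos_def_mat n D"
    and P: "P \<in> carrier_mat n n"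
    and mono: "\<And>y. y \<in> carrier_vec n \<Longrightarrow> 0 \<le> (T *\<^sub>v y) \<bullet> (P *\<^sub>v y)"
    and s: "s > 0"
    and Q: "Q = s \<cdot>\<^sub>m (D * T)"
    and A: "A = transpose_mat T * D * T"
    and S: "S = T * (s\<^sup>2 \<cdot>\<^sub>m D) * transpose_mat T + T * P * inv_mat A * transpose_mat (T * P)"
    and H: "H = T * (P + Q) * inv_mat A * transpose_mat (P + Q) * transpose_mat T"
  shows "pos_def_mat n A" "pos_def_mat n H" "S \<in> carrier_mat n n" "transpose_mat S = S"
    and "\<And>x. x \<in> carrier_vec n \<Longrightarrow> 1 / 2 * (x \<bullet> (H *\<^sub>v x)) \<le> x \<bullet> (S *\<^sub>v x)"
    and "\<And>x. x \<in> carrier_vec n \<Longrightarrow> x \<bullet> (S *\<^sub>v x) \<le> x \<bullet> (H *\<^sub>v x)"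
proof -
  have Dc: "D \<in> carrier_mat n n" "transpose_mat D = D" using D by (auto simp: pos_def_mat_def)
  show Apd: "pos_def_mat n A"
    unfolding A by (rule pos_def_mat_congruence[OF D T inj])
  define Ai where "Ai = inv_mat A"
  have Aipd: "pos_def_mat n Ai" unfolding Ai_def by (rule pos_def_mat_inv_mat[OF Apd])
  then have Aic: "Ai \<in> carrier_mat n n" "transpose_mat Ai = Ai" by (auto simp: pos_def_mat_def)
  have Ac: "A \<in> carrier_mat n n" "transpose_mat A = A" using Apd by (auto simp: pos_def_mat_def)
  have AiA: "Ai * A = 1\<^sub>m n" using pos_def_mat_inv[OF Apd] by (simp add: Ai_def)
  have Qc: "Q \<in> carrier_mat n n" using Q T Dc by simp
  have sq [simp]: "X * Y \<in> carrier_mat n n" if "X \<in> carrier_mat n n" "Y \<in> carrier_mat n n"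
    for X Y :: "real mat"
    using that by (rule mult_carrier_mat)
  note c = T Dc(1) P Aic(1) Ac(1) Qc
  have tr: "transpose_mat (X * Y * transpose_mat X) = X * Y * transpose_mat X"
    if "X \<in> carrier_mat n n" "Y \<in> carrier_mat n n" "transpose_mat Y = Y" for X Y :: "real mat"
    using that by (simp add: transpose_mult[of _ n n _ n] assoc_mult_mat[of _ n n _ n _ n])
  have S1: "S = T * (s\<^sup>2 \<cdot>\<^sub>m D) * transpose_mat T + (T * P) * Ai * transpose_mat (T * P)"
    by (simp add: S Ai_def)
  \<comment> \<open>Regrouped as \<open>X Y X^T\<close>, the shape from which both symmetry
    (\<open>tr\<close>) and the value of the quadratic form (\<open>congr\<close>) are read
    off.\<close>
  have H1: "H = (T * (P + Q)) * Ai * transpose_mat (T * (P + Q))"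
  proof -
    define X where "X = P + Q"
    have X: "X \<in> carrier_mat n n" "transpose_mat X \<in> carrier_mat n n" "transpose_mat T \<in> carrier_mat n n"
      using c by (simp_all add: X_def)
    show ?thesis
      unfolding H Ai_def[symmetric] X_def[symmetric] using X c
      by (simp add: transpose_mult[of _ n n _ n] assoc_mult_mat[of _ n n _ n _ n])
  qed
  show Sc: "S \<in> carrier_mat n n" unfolding S1 using c by simp
  have "transpose_mat (s\<^sup>2 \<cdot>\<^sub>m D) = s\<^sup>2 \<cdot>\<^sub>m D" using Dc by (intro eq_matI) (auto simp: mat_eq_iff)
  then show St: "transpose_mat S = S"
    unfolding S1 using c Dc Aic tr[of T "s\<^sup>2 \<cdot>\<^sub>m D"] tr[of "T * P" Ai]
    by (simp add: transpose_add[of _ n n] del: assoc_mult_mat)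
  have Hc: "H \<in> carrier_mat n n" unfolding H1 using c by simp
  have Ht: "transpose_mat H = H" unfolding H1 using c Aic by (intro tr) auto
  have congr: "x \<bullet> (X * Y * transpose_mat X *\<^sub>v x) = (transpose_mat X *\<^sub>v x) \<bullet> (Y *\<^sub>v (transpose_mat X *\<^sub>v x))"
    if "X \<in> carrier_mat n n" "Y \<in> carrier_mat n n" "x \<in> carrier_vec n" for X Y :: "real mat" and x
    using that scalar_prod_transpose_mult_vec[of "transpose_mat X" n n x "Y *\<^sub>v (transpose_mat X *\<^sub>v x)"]
    by (simp add: assoc_mult_mat_vec[of _ n n _ n] del: assoc_mult_mat)
  have surj: "\<exists>y\<in>carrier_vec n. T *\<^sub>v y = u" if u: "u \<in> carrier_vec n" for u
  proof
    note i = inv_mat_nonsingular[OF T inj]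
    show "inv_mat T *\<^sub>v u \<in> carrier_vec n" using i(1) u by simp
    have "T *\<^sub>v (inv_mat T *\<^sub>v u) = T * inv_mat T *\<^sub>v u"
      using i(1) u T by (intro assoc_mult_mat_vec[symmetric]) auto
    also have "\<dots> = u" using i(2) u by simp
    finally show "T *\<^sub>v (inv_mat T *\<^sub>v u) = u" .
  qed
  have key: "1 / 2 * (x \<bullet> (H *\<^sub>v x)) \<le> x \<bullet> (S *\<^sub>v x) \<and> x \<bullet> (S *\<^sub>v x) \<le> x \<bullet> (H *\<^sub>v x) \<and>
      (x \<noteq> 0\<^sub>v n \<longrightarrow> 0 < x \<bullet> (H *\<^sub>v x))" if x: "x \<in> carrier_vec n" for x
  proof -
    define u where "u = transpose_mat T *\<^sub>v x"
    have u: "u \<in> carrier_vec n" using x T by (simp add: u_def)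
    \<comment> \<open>The witness \<open>y\<close> solves \<open>T y = u\<close>, possible because
      \<open>T\<close> is square and injective. It gives \<open>b = s A y\<close>, hence
      \<open>A^-1 b = s y\<close>, and the inverse disappears from every product with
      \<open>b\<close>.\<close>
    obtain y where y: "y \<in> carrier_vec n" "T *\<^sub>v y = u" using surj[OF u] by blast
    define a b where "a = transpose_mat P *\<^sub>v u" and "b = transpose_mat Q *\<^sub>v u"
    have ab: "a \<in> carrier_vec n" "b \<in> carrier_vec n" using u c by (simp_all add: a_def b_def)
    have Qt: "transpose_mat Q = s \<cdot>\<^sub>m (transpose_mat T * D)"
    proof -
      have "transpose_mat Q = s \<cdot>\<^sub>m transpose_mat (D * T)" unfolding Q by (rule eq_matI) auto
      also have "transpose_mat (D * T) = transpose_mat T * D"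
        using T Dc transpose_mult[of D n n T n] by simp
      finally show ?thesis .
    qed
    have b: "b = s \<cdot>\<^sub>v (A *\<^sub>v y)"
    proof -
      have "A *\<^sub>v y = (transpose_mat T * D) *\<^sub>v u"
        unfolding A y(2)[symmetric] using c y(1) by (intro assoc_mult_mat_vec) auto
      then show ?thesis
        unfolding b_def Qt using c u smult_mat_mult_mat_vec_assoc[of "transpose_mat T * D" n n u s] by simp
    qed
    have Aib: "Ai *\<^sub>v b = s \<cdot>\<^sub>v y"
    proof -
      have "Ai *\<^sub>v (A *\<^sub>v y) = (Ai * A) *\<^sub>v y"
        using c y(1) by (intro assoc_mult_mat_vec[symmetric]) auto
      then show ?thesis using c y(1) AiA by (simp add: b mult_mat_vec[of _ n n])
    qed
    \<comment> \<open>The matching itself: the \<open>b\<close> part reproduces the form of the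
      block \<open>s^2 D\<close>.\<close>
    have bb: "b \<bullet> (Ai *\<^sub>v b) = s\<^sup>2 * (u \<bullet> (D *\<^sub>v u))"
    proof -
      have "b \<bullet> (Ai *\<^sub>v b) = s * (b \<bullet> y)" using ab y by (simp add: Aib)
      also have "b \<bullet> y = y \<bullet> b" using ab y by (intro comm_scalar_prod) auto
      also have "y \<bullet> b = s * (y \<bullet> (A *\<^sub>v y))" using c y by (simp add: b)
      also have "y \<bullet> (A *\<^sub>v y) = u \<bullet> (D *\<^sub>v u)"
        using congr[of "transpose_mat T" D y] c y by (simp add: A)
      finally show ?thesis by (simp add: power2_eq_square)
    qed
    \<comment> \<open>By \<open>A^-1 b = s y\<close> the cross term is \<open>s\<close> times the
      product of \<open>T y\<close> with \<open>P y\<close>.\<close>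
    have cross: "0 \<le> a \<bullet> (Ai *\<^sub>v b)"
    proof -
      have "a \<bullet> (Ai *\<^sub>v b) = s * (a \<bullet> y)" using ab y by (simp add: Aib)
      also have "a \<bullet> y = u \<bullet> (P *\<^sub>v y)"
        unfolding a_def using P y(1) u by (rule transpose_vec_mult_scalar)
      finally show ?thesis using mono[OF y(1)] s y(2) by simp
    qed
    have sym: "b \<bullet> (Ai *\<^sub>v a) = a \<bullet> (Ai *\<^sub>v b)"
      using Aic ab by (intro symmetric_scalar_prod_commute) auto
    have tT: "transpose_mat (T * X) *\<^sub>v x = transpose_mat X *\<^sub>v u" if "X \<in> carrier_mat n n" for X
      using that T x by (simp add: transpose_mult[of _ n n _ n] u_def assoc_mult_mat_vec[of _ n n _ n])
    have qS: "x \<bullet> (S *\<^sub>v x) = b \<bullet> (Ai *\<^sub>v b) + a \<bullet> (Ai *\<^sub>v a)"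
    proof -
      have "x \<bullet> (S *\<^sub>v x) = x \<bullet> (T * (s\<^sup>2 \<cdot>\<^sub>m D) * transpose_mat T *\<^sub>v x)
           + x \<bullet> ((T * P) * Ai * transpose_mat (T * P) *\<^sub>v x)"
        unfolding S1 using c x
        by (subst add_mult_distrib_mat_vec[of _ n n], simp_all)
           (subst scalar_prod_add_distrib[of _ n], simp_all add: mult_mat_vec_carrier[of _ n n])
      also have "x \<bullet> (T * (s\<^sup>2 \<cdot>\<^sub>m D) * transpose_mat T *\<^sub>v x) = b \<bullet> (Ai *\<^sub>v b)"
        using c x u by (subst congr) (auto simp: bb u_def[symmetric] smult_mat_mult_mat_vec_assoc[of D n n u])
      also have "x \<bullet> ((T * P) * Ai * transpose_mat (T * P) *\<^sub>v x) = a \<bullet> (Ai *\<^sub>v a)"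
        using c x by (subst congr) (auto simp: tT a_def)
      finally show ?thesis .
    qed
    have qH: "x \<bullet> (H *\<^sub>v x) = b \<bullet> (Ai *\<^sub>v b) + a \<bullet> (Ai *\<^sub>v a) + 2 * (a \<bullet> (Ai *\<^sub>v b))"
    proof -
      have "x \<bullet> (H *\<^sub>v x) = (transpose_mat (P + Q) *\<^sub>v u) \<bullet> (Ai *\<^sub>v (transpose_mat (P + Q) *\<^sub>v u))"
        unfolding H1 using c x by (subst congr) (auto simp: tT)
      also have "transpose_mat (P + Q) *\<^sub>v u = a + b"
        using c u by (simp add: transpose_add[of _ n n] add_mult_distrib_mat_vec[of _ n n] a_def b_def)
      also have "(a + b) \<bullet> (Ai *\<^sub>v (a + b)) = (a + b) \<bullet> (Ai *\<^sub>v a) + (a + b) \<bullet> (Ai *\<^sub>v b)"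
        using c ab by (simp add: mult_add_distrib_mat_vec[of _ n n] scalar_prod_add_distrib[of _ n])
      also have "\<dots> = b \<bullet> (Ai *\<^sub>v b) + a \<bullet> (Ai *\<^sub>v a) + 2 * (a \<bullet> (Ai *\<^sub>v b))"
        using c ab sym by (simp add: add_scalar_prod_distrib[of _ n])
      finally show ?thesis .
    qed
    \<comment> \<open>The nonnegative quantity |a - b|^2 equals twice the form of \<open>S\<close>
      minus the form of \<open>H\<close>; this is the origin of the constant 1/2.\<close>
    have diff: "0 \<le> b \<bullet> (Ai *\<^sub>v b) + a \<bullet> (Ai *\<^sub>v a) - 2 * (a \<bullet> (Ai *\<^sub>v b))"
    proof -
      have "0 \<le> (a - b) \<bullet> (Ai *\<^sub>v (a - b))"
        using ab by (intro pos_def_mat_nonneg[OF Aipd]) auto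
      also have "\<dots> = (a - b) \<bullet> (Ai *\<^sub>v a) - (a - b) \<bullet> (Ai *\<^sub>v b)"
        using c ab by (simp add: mult_minus_distrib_mat_vec[of _ n n] scalar_prod_minus_distrib[of _ n])
      also have "\<dots> = b \<bullet> (Ai *\<^sub>v b) + a \<bullet> (Ai *\<^sub>v a) - 2 * (a \<bullet> (Ai *\<^sub>v b))"
        using c ab sym by (simp add: minus_scalar_prod_distrib[of _ n])
      finally show ?thesis .
    qed
    \<comment> \<open>Strictness comes from the \<open>b\<close> part alone: \<open>u\<close> is
      nonzero since \<open>T^T\<close> is injective, and \<open>D\<close> is positive definite. The
      remaining terms are nonnegative.\<close>
    have "0 < x \<bullet> (H *\<^sub>v x)" if "x \<noteq> 0\<^sub>v n"
    proof -
      have "u \<noteq> 0\<^sub>v n" using inj'[OF x] that by (auto simp: u_def)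
      then have "0 < b \<bullet> (Ai *\<^sub>v b)" using D u s by (auto simp: bb pos_def_mat_def)
      then show ?thesis using cross pos_def_mat_nonneg[OF Aipd ab(1)] by (simp add: qH)
    qed
    then show ?thesis using cross diff by (simp add: qS qH)
  qed
  show "pos_def_mat n H" using key Hc Ht by (auto simp: pos_def_mat_def)
  show "1 / 2 * (x \<bullet> (H *\<^sub>v x)) \<le> x \<bullet> (S *\<^sub>v x)" "x \<bullet> (S *\<^sub>v x) \<le> x \<bullet> (H *\<^sub>v x)"
    if "x \<in> carrier_vec n" for x using key[OF that] by auto
qed

section \<open>Kronecker products\<close>

lemma sum_lessThan_mult:
  fixes f :: "nat \<Rightarrow> 'a::comm_monoid_add"
  shows "(\<Sum>k<m * n. f k) = (\<Sum>a<m. \<Sum>i<n. f (a * n + i))"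
proof -
  have "(\<Sum>k<m * n. f k) = (\<Sum>a<m. sum f {a * n..<a * n + n})"
    by (rule sum.nat_group[symmetric])
  also have "\<dots> = (\<Sum>a<m. \<Sum>i<n. f (a * n + i))"
  proof (rule sum.cong[OF refl])
    fix a
    show "sum f {a * n..<a * n + n} = (\<Sum>i<n. f (a * n + i))"
      using sum.shift_bounds_nat_ivl[of f 0 "a * n" n] by (simp add: lessThan_atLeast0 add.commute)
  qed
  finally show ?thesis .
qed

text \<open>The bound on \<open>k\<close> already excludes \<open>n = 0\<close>, so the remainder is
  below \<open>n\<close> without a separate positivity assumption.\<close>

lemma less_mult_imp_div_mod_less:
  fixes k m n :: nat
  assumes "k < m * n"
  shows "k div n < m" "k mod n < n"
  using assms by (auto simp: less_mult_imp_div_less intro: mod_less_divisor[OF gr0I])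

lemma mult_add_less_mult:
  fixes a i m n :: nat
  assumes "a < m" "i < n"
  shows "a * n + i < m * n"
proof -
  have "a * n + i < (a + 1) * n" using assms by simp
  also have "\<dots> \<le> m * n" using assms by (intro mult_right_mono) auto
  finally show ?thesis .
qed

lemma kronecker_carrier [simp]:
  assumes "A \<in> carrier_mat m n" "B \<in> carrier_mat p q"
  shows "A \<otimes>\<^sub>K B \<in> carrier_mat (m * p) (n * q)"
  using assms by (auto simp: kronecker_def)

lemma kronecker_dim [simp]:
  "dim_row (A \<otimes>\<^sub>K B) = dim_row A * dim_row B" "dim_col (A \<otimes>\<^sub>K B) = dim_col A * dim_col B"
  by (auto simp: kronecker_def)

lemma kronecker_index [simp]:
  assumes "k < dim_row A * dim_row B" "l < dim_col A * dim_col B"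
  shows "(A \<otimes>\<^sub>K B) $$ (k, l) =
    A $$ (k div dim_row B, l div dim_col B) * B $$ (k mod dim_row B, l mod dim_col B)"
  using assms by (auto simp: kronecker_def)

text \<open>The mixed-product rule: writing the summation index as \<open>b * q + j\<close> turns
  the single sum into a product of two. It serves both to invert \<open>T\<^sub>2\<close> factorwise
  and to split \<open>A_D\<close> off from \<open>M_hat\<close>.\<close>

lemma kronecker_mult:
  fixes A B C D :: "'a::comm_semiring_1 mat"
  assumes "A \<in> carrier_mat m n" "B \<in> carrier_mat p q" "C \<in> carrier_mat n r" "D \<in> carrier_mat q s"
  shows "(A \<otimes>\<^sub>K B) * (C \<otimes>\<^sub>K D) = (A * C) \<otimes>\<^sub>K (B * D)"
proof (rule eq_matI)
  have dims: "dim_row A = m" "dim_col A = n" "dim_row B = p" "dim_col B = q"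
      "dim_row C = n" "dim_col C = r" "dim_row D = q" "dim_col D = s"
    using assms by auto
  fix k l assume "k < dim_row ((A * C) \<otimes>\<^sub>K (B * D))" "l < dim_col ((A * C) \<otimes>\<^sub>K (B * D))"
  then have kl: "k < m * p" "l < r * s" by (simp_all add: dims)
  note less_mult_imp_div_mod_less[OF kl(1)] less_mult_imp_div_mod_less[OF kl(2)]
  note lt = this
  have "((A \<otimes>\<^sub>K B) * (C \<otimes>\<^sub>K D)) $$ (k, l) = (\<Sum>t<n * q. (A \<otimes>\<^sub>K B) $$ (k, t) * (C \<otimes>\<^sub>K D) $$ (t, l))"
    using kl by (simp add: dims scalar_prod_def lessThan_atLeast0)
  also have "\<dots> = (\<Sum>b<n. \<Sum>j<q. (A $$ (k div p, b) * C $$ (b, l div s)) * (B $$ (k mod p, j) * D $$ (j, l mod s)))"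
    unfolding sum_lessThan_mult
  proof (intro sum.cong refl)
    fix b j assume "b \<in> {..<n}" "j \<in> {..<q}"
    then have "j < q" "b * q + j < n * q" by (auto intro: mult_add_less_mult)
    then show "(A \<otimes>\<^sub>K B) $$ (k, b * q + j) * (C \<otimes>\<^sub>K D) $$ (b * q + j, l) =
        (A $$ (k div p, b) * C $$ (b, l div s)) * (B $$ (k mod p, j) * D $$ (j, l mod s))"
      using kl by (simp add: dims mult.assoc mult.left_commute)
  qed
  also have "\<dots> = (A * C) $$ (k div p, l div s) * (B * D) $$ (k mod p, l mod s)"
    using lt by (simp add: dims scalar_prod_def lessThan_atLeast0 sum_product)
  also have "\<dots> = ((A * C) \<otimes>\<^sub>K (B * D)) $$ (k, l)"
    using kl by (simp add: dims)
  finally show "((A \<otimes>\<^sub>K B) * (C \<otimes>\<^sub>K D)) $$ (k, l) = ((A * C) \<otimes>\<^sub>K (B * D)) $$ (k, l)" .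
qed (use assms in auto)

lemma kronecker_one:
  "(1\<^sub>m m :: 'a::semiring_1 mat) \<otimes>\<^sub>K 1\<^sub>m n = 1\<^sub>m (m * n)"
proof (rule eq_matI)
  fix k l assume "k < dim_row (1\<^sub>m (m * n) :: 'a mat)" "l < dim_col (1\<^sub>m (m * n) :: 'a mat)"
  then have kl: "k < m * n" "l < m * n" by simp_all
  note lt = less_mult_imp_div_mod_less[OF kl(1)] less_mult_imp_div_mod_less[OF kl(2)]
  show "((1\<^sub>m m :: 'a mat) \<otimes>\<^sub>K 1\<^sub>m n) $$ (k, l) = 1\<^sub>m (m * n) $$ (k, l)"
  proof (cases "k = l")
    case False
    then have "k div n \<noteq> l div n \<or> k mod n \<noteq> l mod n"
      using div_mult_mod_eq[of k n] div_mult_mod_eq[of l n] by metis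
    then show ?thesis using False kl lt by auto
  qed (use kl lt in simp)
qed auto

section \<open>Block vectors, one block per time step\<close>

text \<open>In an all-at-once vector, block \<open>a\<close> holds the finite element coefficients
  of one time step, counted from 0.\<close>

definition vec_block :: "nat \<Rightarrow> 'a vec \<Rightarrow> nat \<Rightarrow> 'a vec" where
  "vec_block n v a = vec n (\<lambda>i. v $ (a * n + i))"

lemma vec_block_carrier [simp]: "vec_block n v a \<in> carrier_vec n" "dim_vec (vec_block n v a) = n"
  by (auto simp: vec_block_def)

lemma vec_block_index [simp]: "i < n \<Longrightarrow> vec_block n v a $ i = v $ (a * n + i)"
  by (simp add: vec_block_def)

lemma scalar_prod_vec_block:
  fixes u v :: "'a::comm_semiring_0 vec"
  assumes "u \<in> carrier_vec (m * n)" "v \<in> carrier_vec (m * n)"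
  shows "u \<bullet> v = (\<Sum>a<m. vec_block n u a \<bullet> vec_block n v a)"
  using assms by (simp add: scalar_prod_def lessThan_atLeast0[symmetric] sum_lessThan_mult)

lemma vec_block_eq_0_imp:
  fixes v :: "'a::zero vec"
  assumes "v \<in> carrier_vec (m * n)" "\<And>a. a < m \<Longrightarrow> vec_block n v a = 0\<^sub>v n"
  shows "v = 0\<^sub>v (m * n)"
proof (rule eq_vecI)
  fix k assume "k < dim_vec (0\<^sub>v (m * n) :: 'a vec)"
  then have k: "k < m * n" by simp
  note lt = less_mult_imp_div_mod_less[OF this]
  have "vec_block n v (k div n) $ (k mod n) = 0" using assms(2)[OF lt(1)] lt by simp
  then show "v $ k = 0\<^sub>v (m * n) $ k" using lt k by simp
qed (use assms in auto)

text \<open>Entrywise form of the rule that block \<open>a\<close> of the product is the sum over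
  \<open>b\<close> of \<open>A_ab\<close> times \<open>B v_b\<close>. Inserting the rows of the
  identity and of the subdiagonal matrix yields the block formulas that follow.\<close>

lemma kronecker_mult_vec_index:
  fixes A B :: "'a::comm_semiring_1 mat"
  assumes A: "A \<in> carrier_mat m n" and B: "B \<in> carrier_mat p q" and v: "v \<in> carrier_vec (n * q)"
    and a: "a < m" and i: "i < p"
  shows "((A \<otimes>\<^sub>K B) *\<^sub>v v) $ (a * p + i) = (\<Sum>b<n. A $$ (a, b) * (B *\<^sub>v vec_block q v b) $ i)"
proof -
  have dims: "dim_row A = m" "dim_col A = n" "dim_row B = p" "dim_col B = q" "dim_vec v = n * q"
    using assms by auto
  have k: "a * p + i < m * p" by (rule mult_add_less_mult[OF a i])
  have "((A \<otimes>\<^sub>K B) *\<^sub>v v) $ (a * p + i) = (\<Sum>t<n * q. (A \<otimes>\<^sub>K B) $$ (a * p + i, t) * v $ t)"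
    using k by (simp add: dims scalar_prod_def lessThan_atLeast0)
  also have "\<dots> = (\<Sum>b<n. \<Sum>j<q. A $$ (a, b) * (B $$ (i, j) * v $ (b * q + j)))"
    unfolding sum_lessThan_mult
  proof (intro sum.cong refl)
    fix b j assume "b \<in> {..<n}" "j \<in> {..<q}"
    then have "j < q" "b * q + j < n * q" by (auto intro: mult_add_less_mult)
    then show "(A \<otimes>\<^sub>K B) $$ (a * p + i, b * q + j) * v $ (b * q + j) =
        A $$ (a, b) * (B $$ (i, j) * v $ (b * q + j))"
      using k i by (simp add: dims mult.assoc)
  qed
  also have "\<dots> = (\<Sum>b<n. A $$ (a, b) * (B *\<^sub>v vec_block q v b) $ i)"
    using i by (simp add: dims scalar_prod_def lessThan_atLeast0 sum_distrib_left)
  finally show ?thesis .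
qed

lemma sum_one_mat_row:
  fixes f :: "nat \<Rightarrow> real"
  assumes "a < m"
  shows "(\<Sum>b<m. 1\<^sub>m m $$ (a, b) * f b) = f a"
proof -
  have "(\<Sum>b<m. 1\<^sub>m m $$ (a, b) * f b) = (\<Sum>b<m. if b = a then f b else 0)"
    using assms by (intro sum.cong) auto
  then show ?thesis using assms by simp
qed

lemma sum_subdiagonal_mat_row:
  fixes f :: "nat \<Rightarrow> real"
  assumes "a < m"
  shows "(\<Sum>b<m. subdiagonal_mat m $$ (a, b) * f b) = (if a = 0 then 0 else f (a - 1))"
proof -
  have "(\<Sum>b<m. subdiagonal_mat m $$ (a, b) * f b) = (\<Sum>b<m. if a = Suc b then f b else 0)"
    using assms by (intro sum.cong) (auto simp: subdiagonal_mat_def)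
  also have "\<dots> = (if a = 0 then 0 else f (a - 1))"
    using assms by (cases a) auto
  finally show ?thesis .
qed

lemma subdiagonal_mat_carrier [simp]: "subdiagonal_mat m \<in> carrier_mat m m"
  by (simp add: subdiagonal_mat_def)

lemma vec_block_one_kronecker:
  fixes B :: "real mat"
  assumes B: "B \<in> carrier_mat n n" and v: "v \<in> carrier_vec (m * n)" and a: "a < m"
  shows "vec_block n ((1\<^sub>m m \<otimes>\<^sub>K B) *\<^sub>v v) a = B *\<^sub>v vec_block n v a"
proof (rule eq_vecI)
  fix i assume "i < dim_vec (B *\<^sub>v vec_block n v a)"
  then have i: "i < n" using B by simp
  then have "vec_block n ((1\<^sub>m m \<otimes>\<^sub>K B) *\<^sub>v v) a $ i = ((1\<^sub>m m \<otimes>\<^sub>K B) *\<^sub>v v) $ (a * n + i)" by simp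
  also have "\<dots> = (B *\<^sub>v vec_block n v a) $ i"
    unfolding kronecker_mult_vec_index[OF one_carrier_mat B v a i] by (rule sum_one_mat_row[OF a])
  finally show "vec_block n ((1\<^sub>m m \<otimes>\<^sub>K B) *\<^sub>v v) a $ i = (B *\<^sub>v vec_block n v a) $ i" .
qed (use B in simp)

text \<open>The block before the first one is set to zero, so that the first block row of a
  bidiagonal matrix obeys the same formula as all others.\<close>

definition previous_block :: "nat \<Rightarrow> 'a::zero vec \<Rightarrow> nat \<Rightarrow> 'a vec" where
  "previous_block n v a = (if a = 0 then 0\<^sub>v n else vec_block n v (a - 1))"

lemma previous_block_carrier [simp]: "previous_block n v a \<in> carrier_vec n" "dim_vec (previous_block n v a) = n"
  by (auto simp: previous_block_def)

lemma vec_block_subdiagonal_kronecker: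
  fixes B :: "real mat"
  assumes B: "B \<in> carrier_mat n n" and v: "v \<in> carrier_vec (m * n)" and a: "a < m"
  shows "vec_block n ((subdiagonal_mat m \<otimes>\<^sub>K B) *\<^sub>v v) a = B *\<^sub>v previous_block n v a"
  using assms kronecker_mult_vec_index[OF subdiagonal_mat_carrier B v a]
  by (intro eq_vecI) (auto simp: sum_subdiagonal_mat_row previous_block_def)

text \<open>The form is the sum of the forms of \<open>M\<close> over the blocks; a nonzero vector
  has a nonzero block, and the other summands are nonnegative.\<close>

lemma pos_def_mat_one_kronecker:
  assumes M: "pos_def_mat n M"
  shows "pos_def_mat (m * n) (1\<^sub>m m \<otimes>\<^sub>K M)"
proof -
  have Mc: "M \<in> carrier_mat n n" "transpose_mat M = M" using M by (auto simp: pos_def_mat_def)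
  have Ms: "M $$ (j, i) = M $$ (i, j)" if "i < n" "j < n" for i j
  proof -
    have "M $$ (j, i) = transpose_mat M $$ (i, j)" using Mc(1) that by auto
    then show ?thesis by (simp only: Mc(2))
  qed
  have "transpose_mat (1\<^sub>m m \<otimes>\<^sub>K M) = 1\<^sub>m m \<otimes>\<^sub>K M"
  proof (rule eq_matI)
    fix k l assume "k < dim_row (1\<^sub>m m \<otimes>\<^sub>K M)" "l < dim_col (1\<^sub>m m \<otimes>\<^sub>K M)"
    then have kl: "k < m * n" "l < m * n" using Mc by simp_all
    show "transpose_mat (1\<^sub>m m \<otimes>\<^sub>K M) $$ (k, l) = (1\<^sub>m m \<otimes>\<^sub>K M) $$ (k, l)"
      using kl less_mult_imp_div_mod_less[OF kl(1)] less_mult_imp_div_mod_less[OF kl(2)] Mc Ms by auto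
  qed (use Mc in auto)
  moreover have "0 < x \<bullet> ((1\<^sub>m m \<otimes>\<^sub>K M) *\<^sub>v x)" if x: "x \<in> carrier_vec (m * n)" "x \<noteq> 0\<^sub>v (m * n)" for x
  proof -
    have "x \<bullet> ((1\<^sub>m m \<otimes>\<^sub>K M) *\<^sub>v x) = (\<Sum>a<m. vec_block n x a \<bullet> (M *\<^sub>v vec_block n x a))"
      using x Mc mult_mat_vec_carrier[OF kronecker_carrier[OF one_carrier_mat Mc(1)] x(1)]
      by (subst scalar_prod_vec_block[of _ m n]) (auto simp: vec_block_one_kronecker)
    moreover obtain a where "a < m" "vec_block n x a \<noteq> 0\<^sub>v n"
      using vec_block_eq_0_imp[OF x(1)] x(2) by auto
    then have "0 < (\<Sum>a<m. vec_block n x a \<bullet> (M *\<^sub>v vec_block n x a))"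
      using M pos_def_mat_nonneg[OF M] by (intro sum_pos2[of _ a]) (auto simp: pos_def_mat_def)
    ultimately show ?thesis by simp
  qed
  ultimately show ?thesis
    using kronecker_carrier[OF one_carrier_mat Mc(1)] by (auto simp: pos_def_mat_def)
qed

lemma kronecker_add_left:
  fixes A B C :: "'a::semiring_1 mat"
  assumes "A \<in> carrier_mat m n" "B \<in> carrier_mat m n"
  shows "(A + B) \<otimes>\<^sub>K C = A \<otimes>\<^sub>K C + B \<otimes>\<^sub>K C"
proof (rule eq_matI)
  fix k l assume "k < dim_row (A \<otimes>\<^sub>K C + B \<otimes>\<^sub>K C)" "l < dim_col (A \<otimes>\<^sub>K C + B \<otimes>\<^sub>K C)"
  then have kl: "k < m * dim_row C" "l < n * dim_col C" using assms by auto
  note lt = less_mult_imp_div_mod_less[OF kl(1)] less_mult_imp_div_mod_less[OF kl(2)]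
  show "((A + B) \<otimes>\<^sub>K C) $$ (k, l) = (A \<otimes>\<^sub>K C + B \<otimes>\<^sub>K C) $$ (k, l)"
    using kl lt assms by (simp add: distrib_right)
qed (use assms in auto)

lemma vec_block_add:
  fixes u v :: "'a::semiring_1 vec"
  assumes "u \<in> carrier_vec (m * n)" "v \<in> carrier_vec (m * n)" "a < m"
  shows "vec_block n (u + v) a = vec_block n u a + vec_block n v a"
  using assms by (intro eq_vecI) (auto simp: mult_add_less_mult)

section \<open>The bidiagonal factor and the Crank-Nicolson matrix\<close>

lemma det_one_plus_subdiagonal_mat: "Determinant.det (1\<^sub>m m + subdiagonal_mat m) = 1"
proof -
  have "Determinant.det (1\<^sub>m m + subdiagonal_mat m) = prod_list (diag_mat (1\<^sub>m m + subdiagonal_mat m))"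
    by (intro det_lower_triangular[of m]) (auto simp: subdiagonal_mat_def)
  also have "diag_mat (1\<^sub>m m + subdiagonal_mat m) = map (\<lambda>_. 1) [0..<m]"
    by (auto simp: diag_mat_def subdiagonal_mat_def)
  also have "prod_list \<dots> = 1" by (induction m) auto
  finally show ?thesis .
qed

lemma inverse_imp_mult_vec_eq_0:
  fixes A :: "'a::comm_ring_1 mat"
  assumes "A \<in> carrier_mat n n" "B \<in> carrier_mat n n" "B * A = 1\<^sub>m n"
    "v \<in> carrier_vec n" "A *\<^sub>v v = 0\<^sub>v n"
  shows "v = 0\<^sub>v n"
proof -
  have "v = (B * A) *\<^sub>v v" using assms by simp
  also have "\<dots> = B *\<^sub>v (A *\<^sub>v v)" using assms by (intro assoc_mult_mat_vec) auto
  also have "\<dots> = 0\<^sub>v n" using assms by auto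
  finally show ?thesis .
qed

text \<open>The inverse is \<open>G^-1\<close> tensored with the identity, where \<open>G\<close>
  has determinant 1, and its transpose inverts the transpose. Injectivity of \<open>T\<close> makes
  \<open>A\<close> definite and \<open>T y = u\<close> solvable; that of \<open>T^T\<close> keeps
  \<open>u\<close> nonzero.\<close>

lemma one_plus_subdiagonal_kronecker_injective:
  fixes m n :: nat
  defines "T \<equiv> (1\<^sub>m m + subdiagonal_mat m) \<otimes>\<^sub>K 1\<^sub>m n"
  assumes v: "v \<in> carrier_vec (m * n)"
  shows "T *\<^sub>v v = 0\<^sub>v (m * n) \<Longrightarrow> v = 0\<^sub>v (m * n)"
    and "transpose_mat T *\<^sub>v v = 0\<^sub>v (m * n) \<Longrightarrow> v = 0\<^sub>v (m * n)"
proof -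
  define G where "G = 1\<^sub>m m + subdiagonal_mat m"
  have G: "G \<in> carrier_mat m m" by (simp add: G_def)
  have nz: "Determinant.det G \<noteq> 0"
    using det_one_plus_subdiagonal_mat[of m] by (simp add: G_def)
  note i = inv_mat_nonsingular[OF G]
  have inj: "u = 0\<^sub>v m" if "u \<in> carrier_vec m" "G *\<^sub>v u = 0\<^sub>v m" for u
    using nz det_0_iff_vec_prod_zero[OF G] that by blast
  define R where "R = inv_mat G \<otimes>\<^sub>K 1\<^sub>m n"
  have T: "T = G \<otimes>\<^sub>K 1\<^sub>m n" by (simp add: T_def G_def)
  have c: "T \<in> carrier_mat (m * n) (m * n)" "R \<in> carrier_mat (m * n) (m * n)"
    using G i(1)[OF inj] by (simp_all add: T R_def)
  have RT: "R * T = 1\<^sub>m (m * n)"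
    using G i(1,3)[OF inj] by (simp add: T R_def kronecker_mult[of _ m m _ n n _ m _ n] kronecker_one)
  have TR: "T * R = 1\<^sub>m (m * n)"
    using G i(1,2)[OF inj] by (simp add: T R_def kronecker_mult[of _ m m _ n n _ m _ n] kronecker_one)
  have RT': "transpose_mat R * transpose_mat T = 1\<^sub>m (m * n)"
    using transpose_mult[OF c] TR by simp
  show "T *\<^sub>v v = 0\<^sub>v (m * n) \<Longrightarrow> v = 0\<^sub>v (m * n)"
    by (rule inverse_imp_mult_vec_eq_0[OF c RT v])
  show "transpose_mat T *\<^sub>v v = 0\<^sub>v (m * n) \<Longrightarrow> v = 0\<^sub>v (m * n)"
    using c by (intro inverse_imp_mult_vec_eq_0[OF _ _ RT' v]) auto
qed

lemma sum_diff_previous: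
  fixes q :: "nat \<Rightarrow> real"
  shows "(\<Sum>a<m. q a - (if a = 0 then 0 else q (a - 1))) = (if m = 0 then 0 else q (m - 1))"
  by (induction m) auto

text \<open>Regrouping a block row of \<open>P\<close> gives \<open>c L (b + p) + M (b - p)\<close>,
  with \<open>b\<close> the current and \<open>p\<close> the previous block. The factor
  \<open>T\<close> produces the same sum \<open>b + p\<close>, so \<open>L\<close> is tested against
  its own argument and only its quadratic form enters.\<close>

lemma crank_nicolson_nonneg:
  fixes L M :: "real mat" and c :: real and m n :: nat
  defines "E \<equiv> subdiagonal_mat m"
  defines "T \<equiv> (1\<^sub>m m + E) \<otimes>\<^sub>K 1\<^sub>m n"
    and "P \<equiv> 1\<^sub>m m \<otimes>\<^sub>K (c \<cdot>\<^sub>m L + M) + E \<otimes>\<^sub>K (c \<cdot>\<^sub>m L - M)"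
  assumes M: "pos_def_mat n M" and L: "L \<in> carrier_mat n n"
    and psd: "\<And>x. x \<in> carrier_vec n \<Longrightarrow> 0 \<le> x \<bullet> (L *\<^sub>v x)" and c: "0 \<le> c"
    and y: "y \<in> carrier_vec (m * n)"
  shows "0 \<le> (T *\<^sub>v y) \<bullet> (P *\<^sub>v y)"
proof -
  have Mc: "M \<in> carrier_mat n n" "transpose_mat M = M" using M by (auto simp: pos_def_mat_def)
  define Lp Lm where "Lp = c \<cdot>\<^sub>m L + M" and "Lm = c \<cdot>\<^sub>m L - M"
  have Lc: "Lp \<in> carrier_mat n n" "Lm \<in> carrier_mat n n" using L Mc by (auto simp: Lp_def Lm_def)
  have E: "E \<in> carrier_mat m m" by (simp add: E_def)
  have kc: "1\<^sub>m m \<otimes>\<^sub>K X \<in> carrier_mat (m * n) (m * n)" "E \<otimes>\<^sub>K X \<in> carrier_mat (m * n) (m * n)"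
    if "X \<in> carrier_mat n n" for X :: "real mat" using that E by auto
  define b p where "b = vec_block n y" and "p = previous_block n y"
  have bp [simp]: "b a \<in> carrier_vec n" "p a \<in> carrier_vec n" for a by (auto simp: b_def p_def)
  have block: "vec_block n ((1\<^sub>m m \<otimes>\<^sub>K X + E \<otimes>\<^sub>K Y) *\<^sub>v y) a = X *\<^sub>v b a + Y *\<^sub>v p a"
    if "X \<in> carrier_mat n n" "Y \<in> carrier_mat n n" "a < m" for X Y :: "real mat" and a
  proof -
    have "(1\<^sub>m m \<otimes>\<^sub>K X + E \<otimes>\<^sub>K Y) *\<^sub>v y = (1\<^sub>m m \<otimes>\<^sub>K X) *\<^sub>v y + (E \<otimes>\<^sub>K Y) *\<^sub>v y"
      using kc that y by (intro add_mult_distrib_mat_vec) auto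
    then show ?thesis
      using that y mult_mat_vec_carrier[OF kc(1)[OF that(1)] y] mult_mat_vec_carrier[OF kc(2)[OF that(2)] y]
      by (simp add: vec_block_add vec_block_one_kronecker vec_block_subdiagonal_kronecker E_def b_def p_def)
  qed
  have T1: "T = 1\<^sub>m m \<otimes>\<^sub>K 1\<^sub>m n + E \<otimes>\<^sub>K 1\<^sub>m n"
    unfolding T_def using E by (intro kronecker_add_left[of _ m m]) auto
  have P1: "P = 1\<^sub>m m \<otimes>\<^sub>K Lp + E \<otimes>\<^sub>K Lm" by (simp add: P_def Lp_def Lm_def)
  have Tc: "T \<in> carrier_mat (m * n) (m * n)" unfolding T1 by (intro add_carrier_mat kc) auto
  have Pc: "P \<in> carrier_mat (m * n) (m * n)" unfolding P1 by (intro add_carrier_mat kc Lc)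
  define q where "q = (\<lambda>a. b a \<bullet> (M *\<^sub>v b a))"
  \<comment> \<open>An inequality because the \<open>L\<close> term is dropped. The case
    \<open>a = 0\<close> reflects that the previous block is zero there, so the later sum telescopes
    without an initial term.\<close>
  have step: "q a - (if a = 0 then 0 else q (a - 1)) \<le>
      vec_block n (T *\<^sub>v y) a \<bullet> vec_block n (P *\<^sub>v y) a" if a: "a < m" for a
  proof -
    have Tb: "vec_block n (T *\<^sub>v y) a = b a + p a" unfolding T1 using a by (subst block) auto
    have Pb: "vec_block n (P *\<^sub>v y) a = c \<cdot>\<^sub>v (L *\<^sub>v (b a + p a)) + M *\<^sub>v (b a - p a)"
    proof -
      have "vec_block n (P *\<^sub>v y) a = Lp *\<^sub>v b a + Lm *\<^sub>v p a" unfolding P1 using a Lc by (intro block) auto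
      also have "\<dots> = c \<cdot>\<^sub>v (L *\<^sub>v (b a + p a)) + M *\<^sub>v (b a - p a)"
      proof -
        have Lx: "Lp *\<^sub>v x = c \<cdot>\<^sub>v (L *\<^sub>v x) + M *\<^sub>v x" "Lm *\<^sub>v x = c \<cdot>\<^sub>v (L *\<^sub>v x) - M *\<^sub>v x"
          if "x \<in> carrier_vec n" for x
          using that L Mc by (simp_all add: Lp_def Lm_def add_mult_distrib_mat_vec[of _ n n]
              minus_mult_distrib_mat_vec[of _ n n] smult_mat_mult_mat_vec_assoc[of _ n n])
        have eq: "(c \<cdot>\<^sub>v u + x) + (c \<cdot>\<^sub>v v - z) = c \<cdot>\<^sub>v (u + v) + (x - z)"
          if "u \<in> carrier_vec n" "v \<in> carrier_vec n" "x \<in> carrier_vec n" "z \<in> carrier_vec n"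
          for u v x z :: "real vec"
          using that by (intro eq_vecI) (auto simp: algebra_simps)
        have "Lp *\<^sub>v b a + Lm *\<^sub>v p a = c \<cdot>\<^sub>v (L *\<^sub>v b a + L *\<^sub>v p a) + (M *\<^sub>v b a - M *\<^sub>v p a)"
          unfolding Lx[OF bp(1)] Lx[OF bp(2)] using L Mc(1) by (intro eq) auto
        then show ?thesis
          using L Mc(1) by (simp add: mult_add_distrib_mat_vec[of _ n n] mult_minus_distrib_mat_vec[of _ n n])
      qed
      finally show ?thesis .
    qed
    have z: "b a + p a \<in> carrier_vec n" by simp
    \<comment> \<open>Symmetry of \<open>M\<close> cancels the two mixed terms and leaves a pure
      difference of consecutive energies.\<close>
    have sym: "p a \<bullet> (M *\<^sub>v b a) = b a \<bullet> (M *\<^sub>v p a)"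
      using Mc by (intro symmetric_scalar_prod_commute) auto
    have qp: "p a \<bullet> (M *\<^sub>v p a) = (if a = 0 then 0 else q (a - 1))"
      using Mc by (auto simp: p_def q_def b_def previous_block_def)
    have "(b a + p a) \<bullet> (M *\<^sub>v (b a - p a)) = q a - p a \<bullet> (M *\<^sub>v p a)"
      using Mc sym by (simp add: q_def mult_minus_distrib_mat_vec[of _ n n] scalar_prod_minus_distrib[of _ n]
        add_scalar_prod_distrib[of _ n])
    moreover have "(b a + p a) \<bullet> (c \<cdot>\<^sub>v (L *\<^sub>v (b a + p a)) + M *\<^sub>v (b a - p a)) =
        c * ((b a + p a) \<bullet> (L *\<^sub>v (b a + p a))) + (b a + p a) \<bullet> (M *\<^sub>v (b a - p a))"
      using L Mc z by (simp add: scalar_prod_add_distrib[of _ n])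
    moreover have "0 \<le> c * ((b a + p a) \<bullet> (L *\<^sub>v (b a + p a)))"
      using c psd[OF z] by simp
    ultimately show ?thesis unfolding Tb Pb qp by linarith
  qed
  have "0 \<le> (\<Sum>a<m. q a - (if a = 0 then 0 else q (a - 1)))"
    unfolding sum_diff_previous using pos_def_mat_nonneg[OF M] by (simp add: q_def)
  also have "\<dots> \<le> (\<Sum>a<m. vec_block n (T *\<^sub>v y) a \<bullet> vec_block n (P *\<^sub>v y) a)"
    by (intro sum_mono step) auto
  also have "\<dots> = (T *\<^sub>v y) \<bullet> (P *\<^sub>v y)"
    using Tc Pc y by (intro scalar_prod_vec_block[symmetric]) auto
  finally show ?thesis .
qed

text \<open>Displays \<open>M_hat\<close> as a multiple of \<open>A_D\<close> times
  \<open>T\<^sub>2\<close>, the form demanded of \<open>Q\<close> in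
  \<open>matched_schur_complement\<close>.\<close>

lemma smult_kronecker_one_mult:
  fixes M :: "real mat"
  assumes G: "G \<in> carrier_mat m m" and M: "M \<in> carrier_mat n n"
  shows "c \<cdot>\<^sub>m (G \<otimes>\<^sub>K M) = c \<cdot>\<^sub>m ((1\<^sub>m m \<otimes>\<^sub>K M) * (G \<otimes>\<^sub>K 1\<^sub>m n))"
  using assms by (simp add: kronecker_mult[of _ m m _ n n _ m _ n])

lemma pos_def_mat_smult:
  assumes "pos_def_mat n A" "c > 0"
  shows "pos_def_mat n (c \<cdot>\<^sub>m A)"
proof -
  have A: "A \<in> carrier_mat n n" "transpose_mat A = A" using assms by (auto simp: pos_def_mat_def)
  have "transpose_mat (c \<cdot>\<^sub>m A) = c \<cdot>\<^sub>m transpose_mat A" by (rule eq_matI) auto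
  moreover have "0 < x \<bullet> (c \<cdot>\<^sub>m A *\<^sub>v x)" if "x \<in> carrier_vec n" "x \<noteq> 0\<^sub>v n" for x
  proof -
    have "x \<bullet> (c \<cdot>\<^sub>m A *\<^sub>v x) = c * (x \<bullet> (A *\<^sub>v x))"
      using A that by (simp add: smult_mat_mult_mat_vec_assoc[of _ n n])
    then show ?thesis using assms that by (auto simp: pos_def_mat_def)
  qed
  ultimately show ?thesis using A by (auto simp: pos_def_mat_def)
qed

section \<open>Essentially bounded functions\<close>

text \<open>A class chosen to be stable under products, which integrability is not, and insensitive
  to null sets, where gradients are unspecified. Finite measure of the set is built in so that
  membership implies integrability.\<close>

definition ess_bounded_on :: "'a::euclidean_space set \<Rightarrow> ('a \<Rightarrow> 'b::euclidean_space) \<Rightarrow> bool" where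
  "ess_bounded_on S f \<longleftrightarrow> S \<in> lmeasurable \<and> set_borel_measurable lebesgue S f \<and>
     (\<exists>B. AE x\<in>S in lebesgue. norm (f x) \<le> B)"

lemma ess_bounded_on_integrable:
  assumes "ess_bounded_on S f"
  shows "set_integrable lebesgue S f"
proof -
  obtain B where S: "S \<in> lmeasurable" and f: "(\<lambda>x. indicator S x *\<^sub>R f x) \<in> borel_measurable lebesgue"
    and B: "AE x\<in>S in lebesgue. norm (f x) \<le> B"
    using assms by (auto simp: ess_bounded_on_def set_borel_measurable_def)
  \<comment> \<open>The indicator is doubled because only the cut-off function is known to be
    measurable on the whole space.\<close>
  have "integrable lebesgue (\<lambda>x. indicator S x *\<^sub>R (indicator S x *\<^sub>R f x))"
    using S f B by (intro integrableI_bounded_set_indicator[where B = B])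
      (auto simp: fmeasurable_def elim: eventually_mono)
  then show ?thesis
    by (simp add: set_integrable_def indicator_inter_arith[symmetric])
qed

lemma ess_bounded_on_subset:
  assumes "ess_bounded_on S f" "T \<subseteq> S" "T \<in> lmeasurable"
  shows "ess_bounded_on T f"
proof -
  obtain B where f: "(\<lambda>x. indicator S x *\<^sub>R f x) \<in> borel_measurable lebesgue"
    and B: "AE x\<in>S in lebesgue. norm (f x) \<le> B"
    using assms by (auto simp: ess_bounded_on_def set_borel_measurable_def)
  have "(\<lambda>x. indicator T x *\<^sub>R (indicator S x *\<^sub>R f x)) \<in> borel_measurable lebesgue"
    using assms(3) by (intro borel_measurable_scaleR[OF borel_measurable_indicator f]) auto
  also have "(\<lambda>x. indicator T x *\<^sub>R (indicator S x *\<^sub>R f x)) = (\<lambda>x. indicator T x *\<^sub>R f x)"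
    using assms(2) by (auto simp: indicator_def fun_eq_iff)
  finally have "(\<lambda>x. indicator T x *\<^sub>R f x) \<in> borel_measurable lebesgue" .
  moreover have "AE x\<in>T in lebesgue. norm (f x) \<le> B"
    using B by eventually_elim (use assms(2) in auto)
  ultimately show ?thesis
    using assms(3) by (auto simp: ess_bounded_on_def set_borel_measurable_def)
qed

text \<open>Completeness of Lebesgue measure transfers measurability along equality almost
  everywhere.\<close>

lemma ess_bounded_on_cong_AE:
  assumes g: "ess_bounded_on S g" and eq: "AE x\<in>S in lebesgue. f x = g x"
  shows "ess_bounded_on S f"
proof -
  obtain B where m: "(\<lambda>x. indicator S x *\<^sub>R g x) \<in> borel_measurable lebesgue"
    and B: "AE x\<in>S in lebesgue. norm (g x) \<le> B"
    using g by (auto simp: ess_bounded_on_def set_borel_measurable_def)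
  have "(\<lambda>x. indicator S x *\<^sub>R f x) \<in> borel_measurable lebesgue"
    using m
  proof (rule borel_measurable_AE)
    show "AE x in lebesgue. indicator S x *\<^sub>R g x = indicator S x *\<^sub>R f x"
      using eq by eventually_elim (auto simp: indicator_def)
  qed
  moreover have "AE x\<in>S in lebesgue. norm (f x) \<le> B"
    using B eq by eventually_elim auto
  ultimately show ?thesis
    using g by (auto simp: ess_bounded_on_def set_borel_measurable_def)
qed

lemma ess_bounded_on_const:
  "S \<in> lmeasurable \<Longrightarrow> ess_bounded_on S (\<lambda>_. c)"
  by (auto simp: ess_bounded_on_def set_borel_measurable_def
      intro!: borel_measurable_scaleR borel_measurable_indicator exI[of _ "norm c"])

lemma ess_bounded_on_add:
  assumes "ess_bounded_on S f" "ess_bounded_on S g"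
  shows "ess_bounded_on S (\<lambda>x. f x + g x)"
proof -
  obtain B C where m: "(\<lambda>x. indicator S x *\<^sub>R f x) \<in> borel_measurable lebesgue"
      "(\<lambda>x. indicator S x *\<^sub>R g x) \<in> borel_measurable lebesgue"
    and B: "AE x\<in>S in lebesgue. norm (f x) \<le> B" "AE x\<in>S in lebesgue. norm (g x) \<le> C"
    using assms by (auto simp: ess_bounded_on_def set_borel_measurable_def)
  have "(\<lambda>x. indicator S x *\<^sub>R (f x + g x)) \<in> borel_measurable lebesgue"
    unfolding scaleR_add_right using m by (rule borel_measurable_add)
  moreover have "AE x\<in>S in lebesgue. norm (f x + g x) \<le> B + C"
    using B by eventually_elim (auto intro: norm_triangle_mono)
  ultimately show ?thesis
    using assms by (auto simp: ess_bounded_on_def set_borel_measurable_def)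
qed

lemma ess_bounded_on_inner:
  assumes "ess_bounded_on S f" "ess_bounded_on S g"
  shows "ess_bounded_on S (\<lambda>x. inner (f x) (g x))"
proof -
  obtain B C where m: "(\<lambda>x. indicator S x *\<^sub>R f x) \<in> borel_measurable lebesgue"
      "(\<lambda>x. indicator S x *\<^sub>R g x) \<in> borel_measurable lebesgue"
    and B: "AE x\<in>S in lebesgue. norm (f x) \<le> B" "AE x\<in>S in lebesgue. norm (g x) \<le> C"
    using assms by (auto simp: ess_bounded_on_def set_borel_measurable_def)
  have "(\<lambda>x. inner (indicator S x *\<^sub>R f x) (indicator S x *\<^sub>R g x)) \<in> borel_measurable lebesgue"
    using m by (rule borel_measurable_inner)
  also have "(\<lambda>x. inner (indicator S x *\<^sub>R f x) (indicator S x *\<^sub>R g x)) =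
      (\<lambda>x. indicator S x *\<^sub>R inner (f x) (g x))"
    by (auto simp: indicator_def fun_eq_iff)
  finally have "(\<lambda>x. indicator S x *\<^sub>R inner (f x) (g x)) \<in> borel_measurable lebesgue" .
  moreover have "AE x\<in>S in lebesgue. norm (inner (f x) (g x)) \<le> B * C"
    using B
  proof eventually_elim
    case (elim x)
    have "norm (inner (f x) (g x)) \<le> norm (f x) * norm (g x)"
      using Cauchy_Schwarz_ineq2 by simp
    \<comment> \<open>\<open>B\<close> and \<open>C\<close> carry no sign of their own; at a point
      of \<open>S\<close> they dominate a norm and are therefore nonnegative.\<close>
    also have "\<dots> \<le> B * C" if "x \<in> S"
      using elim that norm_ge_zero[of "f x"] norm_ge_zero[of "g x"]
      by (intro mult_mono) (auto simp del: norm_ge_zero)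
    finally show ?case by auto
  qed
  ultimately show ?thesis
    using assms by (auto simp: ess_bounded_on_def set_borel_measurable_def)
qed

lemma ess_bounded_on_mult:
  fixes f g :: "'a::euclidean_space \<Rightarrow> real"
  assumes "ess_bounded_on S f" "ess_bounded_on S g"
  shows "ess_bounded_on S (\<lambda>x. f x * g x)"
  using ess_bounded_on_inner[OF assms] by simp

lemma ess_bounded_on_diff_const:
  fixes f :: "'a::euclidean_space \<Rightarrow> real"
  assumes "ess_bounded_on S f"
  shows "ess_bounded_on S (\<lambda>x. f x - c)"
  using ess_bounded_on_add[OF assms ess_bounded_on_const[of S "- c"]] assms
  by (simp add: ess_bounded_on_def)

lemma ess_bounded_on_sum:
  assumes "finite I" "S \<in> lmeasurable" "\<And>i. i \<in> I \<Longrightarrow> ess_bounded_on S (f i)"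
  shows "ess_bounded_on S (\<lambda>x. \<Sum>i\<in>I. f i x)"
  using assms(1,3)
  by (induction I rule: finite_induct)
     (auto intro: ess_bounded_on_const[OF assms(2)] ess_bounded_on_add)

lemma continuous_imp_ess_bounded_on:
  assumes "compact S" "continuous_on S f"
  shows "ess_bounded_on S f"
proof -
  obtain B where "\<forall>x\<in>S. norm (f x) \<le> B"
    using compact_imp_bounded[OF compact_continuous_image[OF assms(2,1)]]
    by (auto simp: bounded_iff)
  moreover have "(\<lambda>x. indicator S x *\<^sub>R f x) \<in> borel_measurable borel"
    using assms by (intro borel_measurable_continuous_on_indicator) (auto intro: borel_closed compact_imp_closed)
  then have "(\<lambda>x. indicator S x *\<^sub>R f x) \<in> borel_measurable lebesgue"
    by (simp add: measurable_completion)
  ultimately show ?thesis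
    using lmeasurable_compact[OF assms(1)]
    by (auto simp: ess_bounded_on_def set_borel_measurable_def intro!: exI[of _ B])
qed

lemma ess_bounded_on_indicator_scaleR:
  assumes f: "ess_bounded_on S f" and T: "T \<in> sets lebesgue"
  shows "ess_bounded_on S (\<lambda>x. indicator T x *\<^sub>R f x)"
proof -
  obtain B where m: "(\<lambda>x. indicator S x *\<^sub>R f x) \<in> borel_measurable lebesgue"
    and B: "AE x\<in>S in lebesgue. norm (f x) \<le> B"
    using f by (auto simp: ess_bounded_on_def set_borel_measurable_def)
  have "(\<lambda>x. indicator T x *\<^sub>R (indicator S x *\<^sub>R f x)) \<in> borel_measurable lebesgue"
    by (rule borel_measurable_scaleR[OF borel_measurable_indicator[OF T] m])
  then have "(\<lambda>x. indicator S x *\<^sub>R (indicator T x *\<^sub>R f x)) \<in> borel_measurable lebesgue"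
    by (simp add: mult.commute)
  moreover have "AE x\<in>S in lebesgue. norm (indicator T x *\<^sub>R f x) \<le> B"
    using B by eventually_elim (auto simp: indicator_def intro: order_trans[OF norm_ge_zero])
  ultimately show ?thesis
    using f by (auto simp: ess_bounded_on_def set_borel_measurable_def)
qed

text \<open>Integrability of every entry is what permits pulling the double sum under the integral.
  Applied directly to mass, stiffness and convection, and patch by patch to the
  stabilization.\<close>

lemma quadratic_form_integral_mat:
  fixes f :: "nat \<Rightarrow> nat \<Rightarrow> 'a \<Rightarrow> real"
  assumes int: "\<And>i j. i < n \<Longrightarrow> j < n \<Longrightarrow> set_integrable M S (f i j)" and c: "c \<in> carrier_vec n"
  shows "c \<bullet> (mat n n (\<lambda>(i, j). LINT x:S|M. f i j x) *\<^sub>v c) =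
    (LINT x:S|M. \<Sum>i<n. \<Sum>j<n. c $ i * c $ j * f i j x)"
proof -
  have int': "integrable M (\<lambda>x. c $ i * c $ j * (indicator S x * f i j x))" if "i < n" "j < n" for i j
    using int[OF that] by (intro integrable_mult_right) (simp add: set_integrable_def)
  have "(LINT x:S|M. \<Sum>i<n. \<Sum>j<n. c $ i * c $ j * f i j x) =
      (\<integral>x. (\<Sum>i<n. \<Sum>j<n. c $ i * c $ j * (indicator S x * f i j x)) \<partial>M)"
    unfolding set_lebesgue_integral_def by (simp add: sum_distrib_left ac_simps)
  also have "\<dots> = (\<Sum>i<n. \<integral>x. (\<Sum>j<n. c $ i * c $ j * (indicator S x * f i j x)) \<partial>M)"
    using int' by (intro Bochner_Integration.integral_sum Bochner_Integration.integrable_sum) auto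
  also have "\<dots> = (\<Sum>i<n. \<Sum>j<n. \<integral>x. c $ i * c $ j * (indicator S x * f i j x) \<partial>M)"
    using int' by (intro sum.cong refl Bochner_Integration.integral_sum) auto
  also have "\<dots> = (\<Sum>i<n. \<Sum>j<n. c $ i * c $ j * (LINT x:S|M. f i j x))"
    by (simp add: set_lebesgue_integral_def)
  finally show ?thesis
    using c by (simp add: scalar_prod_def lessThan_atLeast0[symmetric] sum_distrib_left ac_simps)
qed

section \<open>Gradients of piecewise polynomials\<close>

text \<open>Testing both derivatives on \<open>D - D'\<close> gives a vanishing norm. Uniqueness is
  what gives the definite description in \<open>gradient\<close> its value.\<close>

lemma GDERIV_unique:
  assumes "GDERIV f x :> D" "GDERIV f x :> D'"
  shows "D = D'"
proof -
  have "(\<lambda>h. inner h D) = (\<lambda>h. inner h D')"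
    using assms unfolding gderiv_def by (rule has_derivative_unique)
  then have "inner (D - D') D = inner (D - D') D'" by (rule fun_cong)
  then have "inner (D - D') (D - D') = 0" by (simp add: inner_diff_right)
  then show ?thesis by simp
qed

lemma gradient_eqI: "GDERIV f x :> D \<Longrightarrow> gradient f x = D"
  unfolding gradient_def by (rule the_equality) (auto intro: GDERIV_unique)

lemma GDERIV_sum:
  assumes "\<And>i. i \<in> I \<Longrightarrow> GDERIV (f i) x :> D i"
  shows "GDERIV (\<lambda>x. \<Sum>i\<in>I. f i x) x :> (\<Sum>i\<in>I. D i)"
  using assms unfolding gderiv_def inner_sum_right by (rule has_derivative_sum)

text \<open>Continuity is carried along in the induction because it later bounds the gradient on a
  compact set; the product rule also needs the continuity of the factors.\<close>

lemma real_polynomial_function_GDERIV: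
  fixes p :: "'a::euclidean_space \<Rightarrow> real"
  assumes "real_polynomial_function p"
  shows "\<exists>g. continuous_on UNIV g \<and> (\<forall>x. GDERIV p x :> g x)"
  using assms
proof (induction p rule: real_polynomial_function.induct)
  case (linear f)
  \<comment> \<open>The gradient of a linear functional is its Riesz vector, here written in the
    standard basis.\<close>
  have eq: "f h = inner h (\<Sum>b\<in>Basis. f b *\<^sub>R b)" for h
  proof -
    have "f h = f (\<Sum>b\<in>Basis. inner h b *\<^sub>R b)" by (simp add: euclidean_representation)
    also have "\<dots> = (\<Sum>b\<in>Basis. inner h b * f b)"
      using linear by (simp add: linear_sum[OF bounded_linear.linear] linear_cmul[OF bounded_linear.linear])
    also have "\<dots> = inner h (\<Sum>b\<in>Basis. f b *\<^sub>R b)" by (simp add: inner_sum_right ac_simps)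
    finally show ?thesis .
  qed
  have "GDERIV f x :> (\<Sum>b\<in>Basis. f b *\<^sub>R b)" for x
    unfolding gderiv_def eq[symmetric] by (rule bounded_linear_imp_has_derivative[OF linear])
  then show ?case by (intro exI[of _ "\<lambda>_. \<Sum>b\<in>Basis. f b *\<^sub>R b"]) auto
next
  case (const c)
  show ?case by (intro exI[of _ "\<lambda>_. 0"]) (auto simp: GDERIV_const)
next
  case (add f g)
  then obtain f' g' where "continuous_on UNIV f'" "\<forall>x. GDERIV f x :> f' x"
    "continuous_on UNIV g'" "\<forall>x. GDERIV g x :> g' x" by blast
  then show ?case
    by (intro exI[of _ "\<lambda>x. f' x + g' x"]) (auto intro: continuous_on_add GDERIV_add)
next
  case (mult f g)
  then obtain f' g' where fg: "continuous_on UNIV f'" "\<forall>x. GDERIV f x :> f' x"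
    "continuous_on UNIV g'" "\<forall>x. GDERIV g x :> g' x" by blast
  have "continuous_on UNIV f" "continuous_on UNIV g"
    using mult by (auto intro: continuous_on_polymonial_function simp: real_polynomial_function_eq)
  then show ?case
    using fg by (intro exI[of _ "\<lambda>x. f x *\<^sub>R g' x + g x *\<^sub>R f' x"])
      (auto intro: GDERIV_mult intro!: continuous_intros)
qed

lemma GDERIV_cong_open:
  assumes "GDERIV g x :> D" "open U" "x \<in> U" "\<And>y. y \<in> U \<Longrightarrow> f y = g y"
  shows "GDERIV f x :> D"
  using assms has_derivative_transform_within_open[of g "\<lambda>h. inner h D" x UNIV U f]
  unfolding gderiv_def by auto

lemma piecewise_polynomial_GDERIV:
  assumes v: "continuous_piecewise_polynomial \<Omega> \<T> v" and x: "T \<in> \<T>" "x \<in> interior T"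
  shows "GDERIV v x :> gradient v x"
proof -
  obtain p where p: "real_polynomial_function p" "\<forall>x\<in>T. v x = p x"
    using v x(1) by (auto simp: continuous_piecewise_polynomial_def)
  obtain g where "\<forall>x. GDERIV p x :> g x"
    using real_polynomial_function_GDERIV[OF p(1)] by blast
  then have "GDERIV v x :> g x"
    using x p interior_subset by (intro GDERIV_cong_open[of p x "g x" "interior T" v]) auto
  then show ?thesis by (simp add: gradient_eqI)
qed

text \<open>The exceptional points lie on the frontiers of finitely many elements, each negligible
  by the definition of a mesh.\<close>

lemma AE_interior_element:
  assumes "fe_mesh \<Omega> \<T>"
  shows "AE x\<in>closure \<Omega> in lebesgue. \<exists>T\<in>\<T>. x \<in> interior T"
proof -
  have "negligible (\<Union>(frontier ` \<T>))"
    using assms by (intro negligible_Union) (auto simp: fe_mesh_def)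
  then have null: "\<Union>(frontier ` \<T>) \<in> null_sets lebesgue" by (simp add: negligible_iff_null_sets)
  show ?thesis
  proof (rule AE_I'[OF null])
    show "{x \<in> space lebesgue. \<not> (x \<in> closure \<Omega> \<longrightarrow> (\<exists>T\<in>\<T>. x \<in> interior T))} \<subseteq> \<Union>(frontier ` \<T>)"
    proof
      fix x assume "x \<in> {x \<in> space lebesgue. \<not> (x \<in> closure \<Omega> \<longrightarrow> (\<exists>T\<in>\<T>. x \<in> interior T))}"
      then have "x \<in> \<Union>\<T>" and i: "\<forall>T\<in>\<T>. x \<notin> interior T" using assms by (auto simp: fe_mesh_def)
      then obtain T where "T \<in> \<T>" "x \<in> T" by blast
      then have "x \<in> frontier T" using i closure_subset by (auto simp: frontier_def)
      with \<open>T \<in> \<T>\<close> show "x \<in> \<Union>(frontier ` \<T>)" by blast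
    qed
  qed
qed

text \<open>On the interior of an element the gradient is that of a polynomial, hence the
  restriction of a globally continuous field. Cutting these fields off to the interiors and summing
  gives a bounded function on the compact closure. The interiors are disjoint, so at almost every
  point exactly one summand survives.\<close>

lemma ess_bounded_on_gradient:
  assumes mesh: "fe_mesh \<Omega> \<T>" and bdd: "bounded \<Omega>"
    and v: "continuous_piecewise_polynomial \<Omega> \<T> v"
  shows "ess_bounded_on (closure \<Omega>) (gradient v)"
proof -
  have "\<forall>T\<in>\<T>. \<exists>g. continuous_on UNIV g \<and> (\<forall>x\<in>interior T. gradient v x = g x)"
  proof
    fix T assume T: "T \<in> \<T>"
    then obtain p where p: "real_polynomial_function p" "\<forall>x\<in>T. v x = p x"
      using v by (auto simp: continuous_piecewise_polynomial_def)
    obtain g where g: "continuous_on UNIV g" "\<forall>x. GDERIV p x :> g x"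
      using real_polynomial_function_GDERIV[OF p(1)] by blast
    have "GDERIV v x :> g x" if "x \<in> interior T" for x
      using that p g interior_subset by (intro GDERIV_cong_open[of p x "g x" "interior T" v]) auto
    then show "\<exists>g. continuous_on UNIV g \<and> (\<forall>x\<in>interior T. gradient v x = g x)"
      using g by (auto intro!: exI[of _ g] gradient_eqI)
  qed
  then obtain g where g: "\<And>T. T \<in> \<T> \<Longrightarrow> continuous_on UNIV (g T)"
      "\<And>T x. T \<in> \<T> \<Longrightarrow> x \<in> interior T \<Longrightarrow> gradient v x = g T x"
    by metis
  have fin: "finite \<T>" using mesh by (simp add: fe_mesh_def)
  have comp: "compact (closure \<Omega>)" using bdd by simp
  have "ess_bounded_on (closure \<Omega>) (\<lambda>x. \<Sum>T\<in>\<T>. indicator (interior T) x *\<^sub>R g T x)"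
    using g(1) comp fin
    by (intro ess_bounded_on_sum ess_bounded_on_indicator_scaleR continuous_imp_ess_bounded_on
        lmeasurable_compact) (auto intro: continuous_on_subset)
  then show ?thesis
  proof (rule ess_bounded_on_cong_AE)
    show "AE x\<in>closure \<Omega> in lebesgue. gradient v x = (\<Sum>T\<in>\<T>. indicator (interior T) x *\<^sub>R g T x)"
      using AE_interior_element[OF mesh]
    proof eventually_elim
      case (elim x)
      show ?case
      proof
        assume "x \<in> closure \<Omega>"
        with elim obtain T where T: "T \<in> \<T>" "x \<in> interior T" by blast
        have "indicator (interior T') x *\<^sub>R g T' x = (if T' = T then g T x else 0)" if "T' \<in> \<T>" for T'
        proof (cases "T' = T")
          case False
          then have "interior T' \<inter> interior T = {}"
            using mesh that T(1) unfolding fe_mesh_def by blast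
          with T(2) False show ?thesis by (auto simp: indicator_def)
        qed (use T in simp)
        then have "(\<Sum>T\<in>\<T>. indicator (interior T) x *\<^sub>R g T x) = (\<Sum>T'\<in>\<T>. if T' = T then g T x else 0)"
          by (rule sum.cong[OF refl])
        also have "\<dots> = g T x" using fin T by simp
        finally show "gradient v x = (\<Sum>T\<in>\<T>. indicator (interior T) x *\<^sub>R g T x)"
          using g(2)[OF T] by simp
      qed
    qed
  qed
qed

text \<open>The square of a finite element function is in general no longer in the finite element
  space, but it is still a test function for \<open>greens_theorem_applies\<close>, where the degree
  is unrestricted.\<close>

lemma piecewise_polynomial_mult:
  assumes "continuous_piecewise_polynomial \<Omega> \<T> u" "continuous_piecewise_polynomial \<Omega> \<T> v"
  shows "continuous_piecewise_polynomial \<Omega> \<T> (\<lambda>x. u x * v x)"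
  unfolding continuous_piecewise_polynomial_def
proof (intro conjI ballI)
  show "continuous_on (closure \<Omega>) (\<lambda>x. u x * v x)"
    using assms by (auto simp: continuous_piecewise_polynomial_def intro: continuous_on_mult)
  fix T assume "T \<in> \<T>"
  then obtain p q where "real_polynomial_function p" "\<forall>x\<in>T. u x = p x"
    "real_polynomial_function q" "\<forall>x\<in>T. v x = q x"
    using assms unfolding continuous_piecewise_polynomial_def by meson
  then show "\<exists>p. real_polynomial_function p \<and> (\<forall>x\<in>T. u x * v x = p x)"
    by (intro exI[of _ "\<lambda>x. p x * q x"]) auto
qed

lemma piecewise_polynomial_combination:
  fixes \<phi> :: "nat \<Rightarrow> 'a::euclidean_space \<Rightarrow> real"
  assumes "\<And>i. i < n \<Longrightarrow> continuous_piecewise_polynomial \<Omega> \<T> (\<phi> i)"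
  shows "continuous_piecewise_polynomial \<Omega> \<T> (\<lambda>x. \<Sum>i<n. c i * \<phi> i x)"
  unfolding continuous_piecewise_polynomial_def
proof (intro conjI ballI)
  show "continuous_on (closure \<Omega>) (\<lambda>x. \<Sum>i<n. c i * \<phi> i x)"
    using assms by (auto simp: continuous_piecewise_polynomial_def intro!: continuous_intros)
  fix T assume "T \<in> \<T>"
  then have "\<forall>i\<in>{..<n}. \<exists>p. real_polynomial_function p \<and> (\<forall>x\<in>T. \<phi> i x = p x)"
    using assms by (auto simp: continuous_piecewise_polynomial_def)
  then obtain p where "\<forall>i\<in>{..<n}. real_polynomial_function (p i) \<and> (\<forall>x\<in>T. \<phi> i x = p i x)"
    by (rule bchoice[THEN exE])
  then show "\<exists>p. real_polynomial_function p \<and> (\<forall>x\<in>T. (\<Sum>i<n. c i * \<phi> i x) = p x)"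
    by (intro exI[of _ "\<lambda>x. \<Sum>i<n. c i * p i x"] conjI real_polynomial_function_sum
        real_polynomial_function.intros(4) real_polynomial_function.intros(2)) auto
qed

lemma gradient_combination:
  assumes "\<And>i. i < n \<Longrightarrow> continuous_piecewise_polynomial \<Omega> \<T> (\<phi> i)"
    and "T \<in> \<T>" "x \<in> interior T"
  shows "gradient (\<lambda>x. \<Sum>i<n. c i * \<phi> i x) x = (\<Sum>i<n. c i *\<^sub>R gradient (\<phi> i) x)"
proof (intro gradient_eqI GDERIV_sum)
  fix i assume "i \<in> {..<n}"
  then have "GDERIV (\<phi> i) x :> gradient (\<phi> i) x"
    using assms by (intro piecewise_polynomial_GDERIV) auto
  from GDERIV_mult[OF GDERIV_const this, of "c i"]
  show "GDERIV (\<lambda>x. c i * \<phi> i x) x :> c i *\<^sub>R gradient (\<phi> i) x" by simp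
qed

lemma gradient_square:
  assumes "continuous_piecewise_polynomial \<Omega> \<T> v" "T \<in> \<T>" "x \<in> interior T"
  shows "gradient (\<lambda>x. v x * v x) x = (2 * v x) *\<^sub>R gradient v x"
  using GDERIV_mult[OF piecewise_polynomial_GDERIV[OF assms] piecewise_polynomial_GDERIV[OF assms]]
  by (intro gradient_eqI) (simp add: scaleR_2[symmetric] mult.commute flip: scaleR_add_left)

section \<open>Finite element matrices as quadratic forms\<close>

text \<open>With \<open>f = g\<close> the right-hand side is a square, which gives Gram matrices
  their sign.\<close>

lemma sum_sum_mult_eq:
  fixes f g :: "nat \<Rightarrow> real"
  shows "(\<Sum>i<n. \<Sum>j<n. c $ i * c $ j * (f i * g j)) = (\<Sum>i<n. c $ i * f i) * (\<Sum>j<n. c $ j * g j)"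
  by (simp add: sum_product ac_simps)

lemma fe_basis_cpp:
  assumes "fe_basis \<Omega> \<T> \<Gamma> n \<phi>" "i < n"
  shows "continuous_piecewise_polynomial \<Omega> \<T> (\<phi> i)"
  using assms by (simp add: fe_basis_def)

lemma ess_bounded_on_cpp:
  assumes "bounded \<Omega>" "continuous_piecewise_polynomial \<Omega> \<T> v"
  shows "ess_bounded_on (closure \<Omega>) v"
  using assms by (intro continuous_imp_ess_bounded_on) (auto simp: continuous_piecewise_polynomial_def)

text \<open>The form is the integral of \<open>v^2\<close> for the combination \<open>v\<close> with
  coefficients \<open>c\<close>. If it vanishes, the set where \<open>v\<close> is nonzero is null;
  it is also open by continuity, hence empty, and linear independence on the domain gives
  \<open>c = 0\<close>.\<close>

lemma pos_def_mass_mat: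
  assumes op: "open \<Omega>" and bdd: "bounded \<Omega>" and basis: "fe_basis \<Omega> \<T> \<Gamma> n \<phi>"
  shows "pos_def_mat n (mass_mat \<Omega> n \<phi>)"
proof -
  note cpp = fe_basis_cpp[OF basis]
  have meas: "\<Omega> \<in> lmeasurable" using op bdd by (simp add: lmeasurable_open)
  have eb: "ess_bounded_on \<Omega> (\<phi> i)" if "i < n" for i
    using ess_bounded_on_cpp[OF bdd cpp[OF that]] closure_subset meas by (rule ess_bounded_on_subset)
  have "transpose_mat (mass_mat \<Omega> n \<phi>) = mass_mat \<Omega> n \<phi>"
    by (rule eq_matI) (auto simp: mass_mat_def mult.commute)
  moreover have "0 < c \<bullet> (mass_mat \<Omega> n \<phi> *\<^sub>v c)" if c: "c \<in> carrier_vec n" "c \<noteq> 0\<^sub>v n" for c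
  proof -
    define v where "v = (\<lambda>x. \<Sum>i<n. c $ i * \<phi> i x)"
    have vcpp: "continuous_piecewise_polynomial \<Omega> \<T> v"
      unfolding v_def by (rule piecewise_polynomial_combination[OF cpp])
    have ebv: "ess_bounded_on \<Omega> v"
      using ess_bounded_on_cpp[OF bdd vcpp] closure_subset meas by (rule ess_bounded_on_subset)
    have "c \<bullet> (mass_mat \<Omega> n \<phi> *\<^sub>v c) = (LINT x:\<Omega>|lebesgue. \<Sum>i<n. \<Sum>j<n. c $ i * c $ j * (\<phi> i x * \<phi> j x))"
      unfolding mass_mat_def using eb c(1)
      by (intro quadratic_form_integral_mat ess_bounded_on_integrable ess_bounded_on_mult)
    also have "\<dots> = (LINT x:\<Omega>|lebesgue. v x * v x)"
      by (simp only: sum_sum_mult_eq v_def)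
    finally have eq: "c \<bullet> (mass_mat \<Omega> n \<phi> *\<^sub>v c) = (\<integral>x. indicator \<Omega> x * (v x * v x) \<partial>lebesgue)"
      by (simp add: set_lebesgue_integral_def)
    have int: "integrable lebesgue (\<lambda>x. indicator \<Omega> x * (v x * v x))"
      using ess_bounded_on_integrable[OF ess_bounded_on_mult[OF ebv ebv]] by (simp add: set_integrable_def)
    have "0 \<le> (\<integral>x. indicator \<Omega> x * (v x * v x) \<partial>lebesgue)"
      by (intro Bochner_Integration.integral_nonneg) auto
    moreover have "(\<integral>x. indicator \<Omega> x * (v x * v x) \<partial>lebesgue) \<noteq> 0"
    proof
      assume "(\<integral>x. indicator \<Omega> x * (v x * v x) \<partial>lebesgue) = 0"
      then have "AE x in lebesgue. indicator \<Omega> x * (v x * v x) = 0"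
        using integral_nonneg_eq_0_iff_AE[OF int] by auto
      then have ae: "AE x in lebesgue. x \<notin> {x \<in> \<Omega>. v x \<noteq> 0}"
        by eventually_elim (auto simp: indicator_def)
      have cont: "continuous_on \<Omega> v"
        using vcpp closure_subset by (auto simp: continuous_piecewise_polynomial_def intro: continuous_on_subset)
      have o: "open {x \<in> \<Omega>. v x \<noteq> 0}"
      proof -
        have "open (\<Omega> \<inter> v -` (- {0}))"
          using cont op by (intro continuous_open_preimage) auto
        moreover have "\<Omega> \<inter> v -` (- {0}) = {x \<in> \<Omega>. v x \<noteq> 0}" by auto
        ultimately show ?thesis by simp
      qed
      then have "{x \<in> \<Omega>. v x \<noteq> 0} \<in> null_sets lebesgue"
        using ae by (subst AE_iff_null_sets) auto
      then have "{x \<in> \<Omega>. v x \<noteq> 0} = {}"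
        using open_not_negligible[OF o] by (auto simp: negligible_iff_null_sets)
      then have "\<forall>i<n. c $ i = 0"
        using basis by (auto simp: fe_basis_def v_def)
      then have "c = 0\<^sub>v n" using c(1) by (intro eq_vecI) auto
      with c(2) show False ..
    qed
    ultimately show ?thesis by (metis eq less_le)
  qed
  ultimately show ?thesis by (auto simp: pos_def_mat_def mass_mat_def)
qed

lemma stiffness_mat_nonneg:
  assumes op: "open \<Omega>" and bdd: "bounded \<Omega>" and mesh: "fe_mesh \<Omega> \<T>"
    and basis: "fe_basis \<Omega> \<T> \<Gamma> n \<phi>" and c: "c \<in> carrier_vec n"
  shows "0 \<le> c \<bullet> (stiffness_mat \<Omega> n \<phi> *\<^sub>v c)"
proof -
  have meas: "\<Omega> \<in> lmeasurable" using op bdd by (simp add: lmeasurable_open)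
  have eb: "ess_bounded_on \<Omega> (gradient (\<phi> i))" if "i < n" for i
    using ess_bounded_on_gradient[OF mesh bdd fe_basis_cpp[OF basis that]] closure_subset meas
    by (rule ess_bounded_on_subset)
  have "c \<bullet> (stiffness_mat \<Omega> n \<phi> *\<^sub>v c) =
      (LINT x:\<Omega>|lebesgue. \<Sum>i<n. \<Sum>j<n. c $ i * c $ j * inner (gradient (\<phi> i) x) (gradient (\<phi> j) x))"
    unfolding stiffness_mat_def using eb c
    by (intro quadratic_form_integral_mat ess_bounded_on_integrable ess_bounded_on_inner)
  also have "\<dots> = (LINT x:\<Omega>|lebesgue.
      inner (\<Sum>i<n. c $ i *\<^sub>R gradient (\<phi> i) x) (\<Sum>i<n. c $ i *\<^sub>R gradient (\<phi> i) x))"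
    unfolding inner_sum_left unfolding inner_sum_right by (simp add: ac_simps)
  also have "\<dots> \<ge> 0"
    unfolding set_lebesgue_integral_def by (intro Bochner_Integration.integral_nonneg) auto
  finally show ?thesis .
qed

text \<open>Green's formula for the square of a finite element function: both the divergence and the
  boundary integral vanish.\<close>

lemma convection_mat_eq_0:
  assumes op: "open \<Omega>" and bdd: "bounded \<Omega>" and mesh: "fe_mesh \<Omega> \<T>"
    and basis: "fe_basis \<Omega> \<T> \<Gamma>\<^sub>D n \<phi>" and boundary: "frontier \<Omega> \<subseteq> \<Gamma>\<^sub>D \<union> \<Gamma>\<^sub>N"
    and wind: "greens_theorem_applies \<Omega> \<T> w"
    and div_free: "\<forall>x\<in>\<Omega>. divergence w x = 0"
    and no_flux: "\<forall>x\<in>\<Gamma>\<^sub>N. inner (w x) (outer_normal \<Omega> x) = 0"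
    and c: "c \<in> carrier_vec n"
  shows "c \<bullet> (convection_mat \<Omega> w n \<phi> *\<^sub>v c) = 0"
proof -
  note cpp = fe_basis_cpp[OF basis]
  have meas: "\<Omega> \<in> lmeasurable" using op bdd by (simp add: lmeasurable_open)
  have ebw: "ess_bounded_on \<Omega> w"
  proof (rule ess_bounded_on_subset[OF _ closure_subset meas])
    show "ess_bounded_on (closure \<Omega>) w"
      using wind bdd by (intro continuous_imp_ess_bounded_on) (auto simp: greens_theorem_applies_def)
  qed
  have ebg: "ess_bounded_on \<Omega> (gradient u)" if "continuous_piecewise_polynomial \<Omega> \<T> u" for u
    using ess_bounded_on_gradient[OF mesh bdd that] closure_subset meas by (rule ess_bounded_on_subset)
  have eb: "ess_bounded_on \<Omega> u" if "continuous_piecewise_polynomial \<Omega> \<T> u" for u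
    using ess_bounded_on_cpp[OF bdd that] closure_subset meas by (rule ess_bounded_on_subset)
  define v where "v = (\<lambda>x. \<Sum>i<n. c $ i * \<phi> i x)"
  have vcpp: "continuous_piecewise_polynomial \<Omega> \<T> v"
    unfolding v_def by (rule piecewise_polynomial_combination[OF cpp])
  have vvcpp: "continuous_piecewise_polynomial \<Omega> \<T> (\<lambda>x. v x * v x)"
    by (rule piecewise_polynomial_mult[OF vcpp vcpp])
  \<comment> \<open>Testing with \<open>v^2\<close> is the device that turns the nonsymmetric
    convection form into an exact divergence.\<close>
  have green: "(LINT x:\<Omega>|lebesgue. inner (w x) (gradient (\<lambda>x. v x * v x) x)) = 0"
  proof -
    have "(LINT x:\<Omega>|lebesgue. inner (w x) (gradient (\<lambda>x. v x * v x) x)) +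
        (LINT x:\<Omega>|lebesgue. v x * v x * divergence w x) =
        (LINT x:frontier \<Omega>|hausdorff_measure (DIM('a) - 1). v x * v x * inner (w x) (outer_normal \<Omega> x))"
      using wind vvcpp by (simp add: greens_theorem_applies_def)
    moreover have "(LINT x:\<Omega>|lebesgue. v x * v x * divergence w x) = 0"
    proof -
      have "indicator \<Omega> x *\<^sub>R (v x * v x * divergence w x) = 0" for x
        using div_free by (auto simp: indicator_def)
      then show ?thesis by (simp only: set_lebesgue_integral_def) simp
    qed
    moreover have "(LINT x:frontier \<Omega>|hausdorff_measure (DIM('a) - 1).
        v x * v x * inner (w x) (outer_normal \<Omega> x)) = 0"
    proof -
      \<comment> \<open>The surface integrand vanishes pointwise: through \<open>v\<close> on the
        Dirichlet part and through the normal component of the wind on the Neumann part.\<close>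
      have "v x = 0" if "x \<in> \<Gamma>\<^sub>D" for x
        using basis that by (simp add: fe_basis_def v_def)
      then have "indicator (frontier \<Omega>) x *\<^sub>R (v x * v x * inner (w x) (outer_normal \<Omega> x)) = 0" for x
        using boundary no_flux by (auto simp: indicator_def)
      then show ?thesis by (simp only: set_lebesgue_integral_def) simp
    qed
    ultimately show ?thesis by simp
  qed
  define G where "G = (\<lambda>x. \<Sum>i<n. \<Sum>j<n. c $ i * c $ j * (inner (w x) (gradient (\<phi> j) x) * \<phi> i x))"
  have G: "G x = v x * inner (w x) (\<Sum>i<n. c $ i *\<^sub>R gradient (\<phi> i) x)" for x
    unfolding G_def v_def inner_sum_right inner_scaleR_right sum_sum_mult_eq[symmetric]
    by (simp add: ac_simps)
  have "c \<bullet> (convection_mat \<Omega> w n \<phi> *\<^sub>v c) = (LINT x:\<Omega>|lebesgue. G x)"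
    unfolding convection_mat_def G_def using eb[OF cpp] ebg[OF cpp] ebw c
    by (intro quadratic_form_integral_mat ess_bounded_on_integrable ess_bounded_on_mult ess_bounded_on_inner)
  \<comment> \<open>The factor 2 anticipates the gradient of \<open>v^2\<close>, which is
    \<open>2 v\<close> times the gradient of \<open>v\<close>.\<close>
  also have "2 * \<dots> = (LINT x:\<Omega>|lebesgue. 2 * G x)"
    by simp
  also have "\<dots> = (LINT x:\<Omega>|lebesgue. inner (w x) (gradient (\<lambda>x. v x * v x) x))"
    unfolding set_lebesgue_integral_def
  proof (rule integral_cong_AE)
    have "ess_bounded_on \<Omega> (\<lambda>x. inner (w x) (gradient (\<lambda>x. v x * v x) x))"
      by (intro ess_bounded_on_inner ebw ebg vvcpp)
    then show m: "(\<lambda>x. indicator \<Omega> x *\<^sub>R inner (w x) (gradient (\<lambda>x. v x * v x) x)) \<in> borel_measurable lebesgue"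
      by (simp add: ess_bounded_on_def set_borel_measurable_def)
    show ae: "AE x in lebesgue. indicator \<Omega> x *\<^sub>R (2 * G x) =
        indicator \<Omega> x *\<^sub>R inner (w x) (gradient (\<lambda>x. v x * v x) x)"
      using AE_interior_element[OF mesh]
    proof eventually_elim
      case (elim x)
      show ?case
      proof (cases "x \<in> \<Omega>")
        case True
        then obtain T where T: "T \<in> \<T>" "x \<in> interior T" using elim closure_subset by blast
        have "gradient (\<lambda>x. v x * v x) x = (2 * v x) *\<^sub>R (\<Sum>i<n. c $ i *\<^sub>R gradient (\<phi> i) x)"
          using gradient_square[OF vcpp T] gradient_combination[where n = n and \<phi> = \<phi> and c = "\<lambda>i. c $ i", OF cpp T]
          by (simp add: v_def)
        then show ?thesis by (simp add: G)
      qed simp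
    qed
    \<comment> \<open>Measurability of this side is inherited from the other one through the
      equality almost everywhere.\<close>
    show "(\<lambda>x. indicator \<Omega> x *\<^sub>R (2 * G x)) \<in> borel_measurable lebesgue"
      using m by (rule borel_measurable_AE) (use ae in eventually_elim, simp only:)
  qed
  also have "\<dots> = 0" by (rule green)
  finally show ?thesis by simp
qed

text \<open>In the only nontrivial case the patch Peclet number exceeds 1, which makes
  \<open>1 - 1/P_k\<close> positive and excludes a vanishing wind at the centroid.\<close>

lemma stabilization_weight_nonneg:
  assumes "h P > 0"
  shows "0 \<le> stabilization_weight \<epsilon> w h P"
  using assms by (auto simp: stabilization_weight_def)

text \<open>\<open>V P\<close> is the Gram matrix of the fluctuations \<open>d P i\<close> on one
  patch, and the stabilization matrix is the weighted sum of these, so the sign can be checked on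
  each patch separately.\<close>

lemma stabilization_mat_nonneg:
  assumes bdd: "bounded \<Omega>" and mesh: "fe_mesh \<Omega> \<T>" and basis: "fe_basis \<Omega> \<T> \<Gamma> n \<phi>"
    and patches: "patch_partition \<T> \<P>" "\<forall>P\<in>\<P>. h P > 0"
    and w: "continuous_on (closure \<Omega>) w" and c: "c \<in> carrier_vec n"
  shows "0 \<le> c \<bullet> (stabilization_mat \<epsilon> w \<P> h n \<phi> *\<^sub>v c)"
proof -
  define g where "g = (\<lambda>i x. inner (w x) (gradient (\<phi> i) x))"
  define d where "d = (\<lambda>P i x. g i x - patch_mean P (g i))"
  define V where "V = (\<lambda>P. mat n n (\<lambda>(i, j). LINT x:P|lebesgue. d P i x * d P j x))"
  have W: "stabilization_mat \<epsilon> w \<P> h n \<phi> $$ (i, j) = (\<Sum>P\<in>\<P>. stabilization_weight \<epsilon> w h P * V P $$ (i, j))"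
    if "i < n" "j < n" for i j
    using that by (simp add: stabilization_mat_def V_def d_def g_def Let_def)
  have Wc: "stabilization_mat \<epsilon> w \<P> h n \<phi> \<in> carrier_mat n n" by (simp add: stabilization_mat_def)
  have form: "c \<bullet> (X *\<^sub>v c) = (\<Sum>i<n. \<Sum>j<n. c $ i * (X $$ (i, j) * c $ j))" if "X \<in> carrier_mat n n" for X
    using that c by (simp add: scalar_prod_def lessThan_atLeast0[symmetric] sum_distrib_left)
  have nonneg: "0 \<le> c \<bullet> (V P *\<^sub>v c)" if P: "P \<in> \<P>" for P
  proof -
    obtain \<Q> where \<Q>: "partition_on \<T> \<Q>" "\<P> = Union ` \<Q>" using patches(1) by (auto simp: patch_partition_def)
    then obtain Q where Q: "Q \<subseteq> \<T>" "P = \<Union>Q" using P by (auto simp: partition_on_def)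
    \<comment> \<open>An element equals the closure of its interior and is closed. A patch is a
      finite union of elements inside a bounded set, hence compact and of finite measure.\<close>
    have "closed T" if "T \<in> \<T>" for T using mesh that unfolding fe_mesh_def by (metis closed_closure)
    then have "closed P"
      using Q mesh by (auto simp: fe_mesh_def intro!: closed_Union intro: finite_subset)
    moreover have sub: "P \<subseteq> closure \<Omega>" using Q mesh by (auto simp: fe_mesh_def)
    ultimately have meas: "P \<in> lmeasurable"
      using bdd by (intro lmeasurable_compact) (auto simp: compact_eq_bounded_closed intro: bounded_subset)
    have "ess_bounded_on P (d P i)" if "i < n" for i
    proof -
      have "ess_bounded_on (closure \<Omega>) (g i)"
        unfolding g_def using bdd w
        by (intro ess_bounded_on_inner continuous_imp_ess_bounded_on
            ess_bounded_on_gradient[OF mesh bdd fe_basis_cpp[OF basis that]]) auto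
      then show ?thesis
        unfolding d_def by (intro ess_bounded_on_diff_const ess_bounded_on_subset[OF _ sub meas])
    qed
    then have "c \<bullet> (V P *\<^sub>v c) = (LINT x:P|lebesgue. \<Sum>i<n. \<Sum>j<n. c $ i * c $ j * (d P i x * d P j x))"
      unfolding V_def using c
      by (intro quadratic_form_integral_mat ess_bounded_on_integrable ess_bounded_on_mult)
    also have "\<dots> \<ge> 0"
      unfolding set_lebesgue_integral_def sum_sum_mult_eq by (intro Bochner_Integration.integral_nonneg) auto
    finally show ?thesis .
  qed
  have "c \<bullet> (stabilization_mat \<epsilon> w \<P> h n \<phi> *\<^sub>v c) =
      (\<Sum>i<n. \<Sum>j<n. \<Sum>P\<in>\<P>. stabilization_weight \<epsilon> w h P * (c $ i * (V P $$ (i, j) * c $ j)))"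
    unfolding form[OF Wc] by (intro sum.cong refl) (simp add: W sum_distrib_left sum_distrib_right ac_simps)
  also have "\<dots> = (\<Sum>P\<in>\<P>. \<Sum>i<n. \<Sum>j<n. stabilization_weight \<epsilon> w h P * (c $ i * (V P $$ (i, j) * c $ j)))"
    by (simp add: sum.swap[of _ \<P>])
  also have "\<dots> = (\<Sum>P\<in>\<P>. stabilization_weight \<epsilon> w h P * (c \<bullet> (V P *\<^sub>v c)))"
  proof -
    have "V P \<in> carrier_mat n n" for P by (simp add: V_def)
    then show ?thesis by (simp add: form sum_distrib_left)
  qed
  also have "\<dots> \<ge> 0"
    using patches(2) nonneg by (intro sum_nonneg mult_nonneg_nonneg stabilization_weight_nonneg) auto
  finally show ?thesis .
qed

section \<open>From the discretized problem to the spectrum\<close>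

theorem corollary4p4:
  fixes \<Omega> \<Gamma>\<^sub>D \<Gamma>\<^sub>N :: "'a::euclidean_space set"
    and w :: "'a \<Rightarrow> 'a"
    and \<T> \<P> :: "'a set set"
    and h :: "'a set \<Rightarrow> real"
    and n\<^sub>x n\<^sub>t :: nat
    and \<phi> :: "nat \<Rightarrow> 'a \<Rightarrow> real"
    and \<epsilon> \<beta> t\<^sub>f \<tau> :: real
    and M K N W L L_plus L_minus I E A_D C_D T\<^sub>1 T\<^sub>2 \<Lambda>\<^sub>2\<^sub>1 M_hat A B C S S_hat :: "real mat"
  assumes dim: "DIM('a) \<in> {1, 2, 3}"
    and domain: "lipschitz_domain \<Omega>"
    and boundary: "\<Gamma>\<^sub>D \<union> \<Gamma>\<^sub>N = frontier \<Omega>" "\<Gamma>\<^sub>D \<inter> \<Gamma>\<^sub>N = {}"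
    and mesh: "fe_mesh \<Omega> \<T>"
    and basis: "fe_basis \<Omega> \<T> \<Gamma>\<^sub>D n\<^sub>x \<phi>"
    and patches: "patch_partition \<T> \<P>" "\<forall>P\<in>\<P>. h P > 0"
    and wind: "greens_theorem_applies \<Omega> \<T> w"
    and div_free: "\<forall>x\<in>\<Omega>. divergence w x = 0"
    and no_flux: "\<forall>x\<in>\<Gamma>\<^sub>N. inner (w x) (outer_normal \<Omega> x) = 0"
    and params: "\<epsilon> > 0" "\<beta> > 0" "t\<^sub>f > 0" "n\<^sub>t \<ge> 1"
    and "M = mass_mat \<Omega> n\<^sub>x \<phi>"
    and "K = stiffness_mat \<Omega> n\<^sub>x \<phi>"
    and "N = convection_mat \<Omega> w n\<^sub>x \<phi>"
    and "W = stabilization_mat \<epsilon> w \<P> h n\<^sub>x \<phi>"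
    and "L = \<epsilon> \<cdot>\<^sub>m K + N + W"
    and "\<tau> = t\<^sub>f / real n\<^sub>t"
    and "L_plus = (\<tau> / 2) \<cdot>\<^sub>m L + M"
    and "L_minus = (\<tau> / 2) \<cdot>\<^sub>m L - M"
    and "I = 1\<^sub>m n\<^sub>t"
    and "E = subdiagonal_mat n\<^sub>t"
    and "A_D = (\<tau> / 2) \<cdot>\<^sub>m (I \<otimes>\<^sub>K M)"
    and "C_D = (\<tau> / (2 * \<beta>)) \<cdot>\<^sub>m (I \<otimes>\<^sub>K M)"
    and "T\<^sub>2 = (I + E) \<otimes>\<^sub>K 1\<^sub>m n\<^sub>x"
    and "T\<^sub>1 = transpose_mat T\<^sub>2"
    and "\<Lambda>\<^sub>2\<^sub>1 = I \<otimes>\<^sub>K L_plus + E \<otimes>\<^sub>K L_minus"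
    and "M_hat = (\<tau> / (2 * sqrt \<beta>)) \<cdot>\<^sub>m ((I + E) \<otimes>\<^sub>K M)"
    and "A = T\<^sub>1 * A_D * transpose_mat T\<^sub>1"
    and "B = T\<^sub>2 * \<Lambda>\<^sub>2\<^sub>1"
    and "C = T\<^sub>2 * C_D * transpose_mat T\<^sub>2"
    and "S = C + B * inv_mat A * transpose_mat B"
    and "S_hat = T\<^sub>2 * (\<Lambda>\<^sub>2\<^sub>1 + M_hat) * inv_mat A * transpose_mat (\<Lambda>\<^sub>2\<^sub>1 + M_hat) * transpose_mat T\<^sub>2"
  shows "invertible_mat A \<and> invertible_mat S_hat \<and>
    (\<forall>\<mu>. eigenvalue (map_mat complex_of_real (inv_mat S_hat * S)) \<mu> \<longrightarrow>
       \<mu> \<in> complex_of_real ` {1 / 2 .. 1})"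
proof -
  have \<Omega>: "open \<Omega>" "bounded \<Omega>" using domain by (auto simp: lipschitz_domain_def)
  have \<tau>: "\<tau> > 0" using params \<open>\<tau> = _\<close> by simp
  have M: "pos_def_mat n\<^sub>x M"
    unfolding \<open>M = _\<close> by (rule pos_def_mass_mat[OF \<Omega> basis])
  then have Mc: "M \<in> carrier_mat n\<^sub>x n\<^sub>x" by (simp add: pos_def_mat_def)
  have KNW: "K \<in> carrier_mat n\<^sub>x n\<^sub>x" "N \<in> carrier_mat n\<^sub>x n\<^sub>x" "W \<in> carrier_mat n\<^sub>x n\<^sub>x"
    by (simp_all add: \<open>K = _\<close> \<open>N = _\<close> \<open>W = _\<close> stiffness_mat_def convection_mat_def stabilization_mat_def)
  then have L: "L \<in> carrier_mat n\<^sub>x n\<^sub>x" by (simp add: \<open>L = _\<close>)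
  have psd: "0 \<le> x \<bullet> (L *\<^sub>v x)" if x: "x \<in> carrier_vec n\<^sub>x" for x
  proof -
    have "0 \<le> x \<bullet> (K *\<^sub>v x)"
      unfolding \<open>K = _\<close> by (rule stiffness_mat_nonneg[OF \<Omega> mesh basis x])
    moreover have "x \<bullet> (N *\<^sub>v x) = 0"
      unfolding \<open>N = _\<close>
      by (rule convection_mat_eq_0[OF \<Omega> mesh basis equalityD2[OF boundary(1)] wind div_free no_flux x])
    moreover have "0 \<le> x \<bullet> (W *\<^sub>v x)"
      unfolding \<open>W = _\<close> using wind
      by (intro stabilization_mat_nonneg[OF \<Omega>(2) mesh basis patches _ x]) (simp add: greens_theorem_applies_def)
    moreover have "x \<bullet> (L *\<^sub>v x) = \<epsilon> * (x \<bullet> (K *\<^sub>v x)) + x \<bullet> (N *\<^sub>v x) + x \<bullet> (W *\<^sub>v x)"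
      using KNW x unfolding \<open>L = _\<close>
      by (simp add: add_mult_distrib_mat_vec[of _ n\<^sub>x n\<^sub>x] smult_mat_mult_mat_vec_assoc[of _ n\<^sub>x n\<^sub>x]
          scalar_prod_add_distrib[of _ n\<^sub>x] add_carrier_vec)
    ultimately show ?thesis using params(1) by simp
  qed
  define m where "m = n\<^sub>t * n\<^sub>x"
  \<comment> \<open>This single constant fits both places: \<open>s^2 A_D = C_D\<close> and
    \<open>s A_D T\<^sub>2 = M_hat\<close>.\<close>
  define s where "s = 1 / sqrt \<beta>"
  have s: "s > 0" "s\<^sup>2 = 1 / \<beta>" using params by (simp_all add: s_def power_divide)
  have E: "E \<in> carrier_mat n\<^sub>t n\<^sub>t" by (simp add: \<open>E = _\<close>)
  have T2: "T\<^sub>2 \<in> carrier_mat m m" using E by (simp add: \<open>T\<^sub>2 = _\<close> \<open>I = _\<close> m_def)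
  have D: "pos_def_mat m A_D"
    unfolding \<open>A_D = _\<close> \<open>I = _\<close> m_def using \<tau> by (intro pos_def_mat_smult pos_def_mat_one_kronecker M) simp
  have P: "\<Lambda>\<^sub>2\<^sub>1 \<in> carrier_mat m m"
    unfolding \<open>\<Lambda>\<^sub>2\<^sub>1 = _\<close> \<open>L_plus = _\<close> \<open>L_minus = _\<close> \<open>I = _\<close> m_def using E L Mc
    by (intro add_carrier_mat kronecker_carrier minus_carrier_mat) auto
  \<comment> \<open>The parameter \<open>c\<close> of the Crank-Nicolson estimate is half the time
    step.\<close>
  have mono: "0 \<le> (T\<^sub>2 *\<^sub>v y) \<bullet> (\<Lambda>\<^sub>2\<^sub>1 *\<^sub>v y)" if "y \<in> carrier_vec m" for y
    using crank_nicolson_nonneg[OF M L psd, of "\<tau> / 2" y n\<^sub>t] \<tau> that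
    by (simp add: \<open>\<Lambda>\<^sub>2\<^sub>1 = _\<close> \<open>L_plus = _\<close> \<open>L_minus = _\<close> \<open>I = _\<close> \<open>T\<^sub>2 = _\<close> \<open>E = _\<close> m_def)
  have Q: "M_hat = s \<cdot>\<^sub>m (A_D * T\<^sub>2)"
  proof -
    have "M_hat = (\<tau> / (2 * sqrt \<beta>)) \<cdot>\<^sub>m ((1\<^sub>m n\<^sub>t \<otimes>\<^sub>K M) * T\<^sub>2)"
      unfolding \<open>M_hat = _\<close> \<open>T\<^sub>2 = _\<close> \<open>I = _\<close> using E Mc by (intro smult_kronecker_one_mult) auto
    also have "\<dots> = s \<cdot>\<^sub>m ((\<tau> / 2) \<cdot>\<^sub>m ((1\<^sub>m n\<^sub>t \<otimes>\<^sub>K M) * T\<^sub>2))"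
      by (rule eq_matI) (simp_all add: s_def)
    also have "(\<tau> / 2) \<cdot>\<^sub>m ((1\<^sub>m n\<^sub>t \<otimes>\<^sub>K M) * T\<^sub>2) = A_D * T\<^sub>2"
      using T2 kronecker_carrier[OF one_carrier_mat[of n\<^sub>t] Mc]
      by (simp add: \<open>A_D = _\<close> \<open>I = _\<close> m_def mult_smult_assoc_mat[of _ m m _ m])
    finally show ?thesis .
  qed
  have C_D: "C_D = s\<^sup>2 \<cdot>\<^sub>m A_D"
    unfolding \<open>C_D = _\<close> \<open>A_D = _\<close> s(2) by (rule eq_matI) auto
  have A': "A = transpose_mat T\<^sub>2 * A_D * T\<^sub>2"
    by (simp add: \<open>A = _\<close> \<open>T\<^sub>1 = _\<close>)
  have S': "S = T\<^sub>2 * (s\<^sup>2 \<cdot>\<^sub>m A_D) * transpose_mat T\<^sub>2 + T\<^sub>2 * \<Lambda>\<^sub>2\<^sub>1 * inv_mat A * transpose_mat (T\<^sub>2 * \<Lambda>\<^sub>2\<^sub>1)"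
    unfolding \<open>S = _\<close> \<open>B = _\<close> \<open>C = _\<close> C_D ..
  have inj: "v \<in> carrier_vec m \<Longrightarrow> T\<^sub>2 *\<^sub>v v = 0\<^sub>v m \<Longrightarrow> v = 0\<^sub>v m"
    "v \<in> carrier_vec m \<Longrightarrow> transpose_mat T\<^sub>2 *\<^sub>v v = 0\<^sub>v m \<Longrightarrow> v = 0\<^sub>v m" for v
    using one_plus_subdiagonal_kronecker_injective[of v n\<^sub>t n\<^sub>x]
    unfolding \<open>T\<^sub>2 = _\<close> \<open>I = _\<close> \<open>E = _\<close> m_def by blast+
  \<comment> \<open>The three open slots are the injectivity of \<open>T\<^sub>2\<close> and of its
    transpose and the sign condition; \<open>inj\<close> and \<open>mono\<close> fill them at each
    use.\<close>
  note schur = matched_schur_complement[OF T2 _ _ D P _ s(1) Q A' S' \<open>S_hat = _\<close>]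
  have A_pd: "pos_def_mat m A"
    by (rule schur(1)) (blast intro: inj mono)+
  have H_pd: "pos_def_mat m S_hat"
    by (rule schur(2)) (blast intro: inj mono)+
  have S: "S \<in> carrier_mat m m" "transpose_mat S = S"
    by (rule schur(3,4); blast intro: inj mono)+
  have lo: "1 / 2 * (x \<bullet> (S_hat *\<^sub>v x)) \<le> x \<bullet> (S *\<^sub>v x)" if "x \<in> carrier_vec m" for x
    by (rule schur(5)[OF _ _ _ that]) (blast intro: inj mono)+
  have hi: "x \<bullet> (S *\<^sub>v x) \<le> 1 * (x \<bullet> (S_hat *\<^sub>v x))" if "x \<in> carrier_vec m" for x
    unfolding mult_1 by (rule schur(6)[OF _ _ _ that]) (blast intro: inj mono)+
  show ?thesis
  proof (intro conjI allI impI)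
    \<comment> \<open>These two facts certify that both occurrences of \<open>inv_mat\<close> in the
      statement are true inverses.\<close>
    show "invertible_mat A" "invertible_mat S_hat"
      by (rule pos_def_mat_inv(4)[OF A_pd], rule pos_def_mat_inv(4)[OF H_pd])
    show "\<mu> \<in> complex_of_real ` {1 / 2..1}"
      if "eigenvalue (map_mat complex_of_real (inv_mat S_hat * S)) \<mu>" for \<mu>
      by (rule quadratic_form_complex_eigenvalue[OF S H_pd lo hi that])
  qed
qed

end
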